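(* Let $\Omega\subset\mathbb{R}^n$ be an open and bounded domain. Let $u\neq 0$ be a non-negative eigenfunction of $\partial\mathcal{J}$, i.e. $u\in W^{1,\infty}_0(\Omega)$, $u\ge 0$, and $\lambda u\in\partial\mathcal{J}(u)$ for some $\lambda>0$. Then $u$ is a ground state of $\mathcal{J}$, i.e. $u$ minimizes $v\mapsto \mathcal{J}(v)/\|v\|_2$ over $v\in W^{1,\infty}_0(\Omega)\setminus\{0\}$.
   Context: $W^{1,\infty}_0(\Omega)=\{u\in W^{1,\infty}(\Omega): u=0\text{ on }\partial\Omega\}$ (Lipschitz functions vanishing on $\partial\Omega$). $\mathcal{J}:L^2(\Omega)\to[0,\infty]$ is $\mathcal{J}(u)=\|\nabla u\|_\infty$ if $u\in W^{1,\infty}_0(\Omega)$ and $+\infty$ otherwise. $\partial\mathcal{J}(u)=\{\zeta\in L^2(\Omega): \langle\zeta,v\rangle\le\mathcal{J}(v)\ \forall v\in L^2(\Omega),\ \langle\zeta,u\rangle=\mathcal{J}(u)\}$ with $\langle\cdot,\cdot\rangle$ the $L^2(\Omega)$ inner product. *)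

theory Defs
  imports "HOL-Analysis.Analysis" "HOL-Probability.Essential_Supremum"
begin

text \<open>
  Elements of \<open>L\<^sup>2(\<Omega>)\<close> and \<open>W\<^sup>1\<^sup>,\<^sup>\<infinity>(\<Omega>)\<close> are represented by functions on the whole space.
  Only their values on \<open>\<Omega>\<close>, up to Lebesgue null sets, matter.
\<close>

section \<open>The space \<open>L\<^sup>2(\<Omega>)\<close>\<close>

definition L2_space :: "'a::euclidean_space set \<Rightarrow> ('a \<Rightarrow> real) set" where
  "L2_space \<Omega> = {f. f \<in> borel_measurable (lebesgue_on \<Omega>) \<and> integrable (lebesgue_on \<Omega>) (\<lambda>x. (f x)\<^sup>2)}"

definition L2_inner :: "'a::euclidean_space set \<Rightarrow> ('a \<Rightarrow> real) \<Rightarrow> ('a \<Rightarrow> real) \<Rightarrow> real" where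
  "L2_inner \<Omega> f g = integral\<^sup>L (lebesgue_on \<Omega>) (\<lambda>x. f x * g x)"

definition L2_norm :: "'a::euclidean_space set \<Rightarrow> ('a \<Rightarrow> real) \<Rightarrow> real" where
  "L2_norm \<Omega> f = sqrt (L2_inner \<Omega> f f)"

definition ae_zero_on :: "'a::euclidean_space set \<Rightarrow> ('a \<Rightarrow> real) \<Rightarrow> bool" where
  "ae_zero_on \<Omega> f \<longleftrightarrow> (AE x in lebesgue_on \<Omega>. f x = 0)"

section \<open>Weak gradients and \<open>W\<^sup>1\<^sup>,\<^sup>\<infinity>(\<Omega>)\<close>\<close>

fun Ck_fun :: "nat \<Rightarrow> ('a::euclidean_space \<Rightarrow> real) \<Rightarrow> bool" where
  "Ck_fun 0 f \<longleftrightarrow> continuous_on UNIV f"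
| "Ck_fun (Suc k) f \<longleftrightarrow> f differentiable_on UNIV \<and>
     (\<forall>b\<in>Basis. Ck_fun k (\<lambda>x. frechet_derivative f (at x) b))"

definition test_functions :: "'a::euclidean_space set \<Rightarrow> ('a \<Rightarrow> real) set" where
  "test_functions \<Omega> =
     {\<phi>. (\<forall>k. Ck_fun k \<phi>) \<and> compact (closure {x. \<phi> x \<noteq> 0}) \<and> closure {x. \<phi> x \<noteq> 0} \<subseteq> \<Omega>}"

definition has_weak_gradient ::
  "'a::euclidean_space set \<Rightarrow> ('a \<Rightarrow> real) \<Rightarrow> ('a \<Rightarrow> 'a) \<Rightarrow> bool" where
  "has_weak_gradient \<Omega> u g \<longleftrightarrow>
     (\<forall>K. compact K \<and> K \<subseteq> \<Omega> \<longrightarrow> u absolutely_integrable_on K \<and> g absolutely_integrable_on K) \<and>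
     (\<forall>\<phi>\<in>test_functions \<Omega>. \<forall>b\<in>Basis.
        integral\<^sup>L (lebesgue_on \<Omega>) (\<lambda>x. u x * frechet_derivative \<phi> (at x) b) =
        - integral\<^sup>L (lebesgue_on \<Omega>) (\<lambda>x. (g x \<bullet> b) * \<phi> x))"

text \<open>Weak gradients on an open set are unique up to null sets, so the choice is immaterial below.\<close>

definition weak_gradient :: "'a::euclidean_space set \<Rightarrow> ('a \<Rightarrow> real) \<Rightarrow> 'a \<Rightarrow> 'a" where
  "weak_gradient \<Omega> u = (SOME g. has_weak_gradient \<Omega> u g)"

definition Linf_norm ::
  "'a::euclidean_space set \<Rightarrow> ('a \<Rightarrow> 'b::real_normed_vector) \<Rightarrow> ereal" where
  "Linf_norm \<Omega> f = esssup (lebesgue_on \<Omega>) (\<lambda>x. ereal (norm (f x)))"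

definition W1inf :: "'a::euclidean_space set \<Rightarrow> ('a \<Rightarrow> real) set" where
  "W1inf \<Omega> = {u. u \<in> borel_measurable (lebesgue_on \<Omega>) \<and> Linf_norm \<Omega> u < \<infinity> \<and>
     (\<exists>g. has_weak_gradient \<Omega> u g \<and> g \<in> borel_measurable (lebesgue_on \<Omega>) \<and> Linf_norm \<Omega> g < \<infinity>)}"

text \<open>
  The boundary condition is imposed on a representative that is continuous up to the boundary.
  For \<open>u\<close> in \<open>W\<^sup>1\<^sup>,\<^sup>\<infinity>(\<Omega>)\<close> with \<open>\<Omega>\<close> open and bounded, such a representative is automatically
  Lipschitz on the closure of \<open>\<Omega>\<close>.
\<close>

definition W1inf0 :: "'a::euclidean_space set \<Rightarrow> ('a \<Rightarrow> real) set" where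
  "W1inf0 \<Omega> = {u \<in> W1inf \<Omega>. \<exists>w. continuous_on (closure \<Omega>) w \<and>
     (AE x in lebesgue_on \<Omega>. u x = w x) \<and> (\<forall>x\<in>frontier \<Omega>. w x = 0)}"

section \<open>The functional, its subdifferential and its ground states\<close>

text \<open>
  The codomain is \<^typ>\<open>ereal\<close> because values are compared with possibly negative inner products.
\<close>

definition J_fun :: "'a::euclidean_space set \<Rightarrow> ('a \<Rightarrow> real) \<Rightarrow> ereal" where
  "J_fun \<Omega> u = (if u \<in> W1inf0 \<Omega> then Linf_norm \<Omega> (weak_gradient \<Omega> u) else \<infinity>)"

definition subdiff_J :: "'a::euclidean_space set \<Rightarrow> ('a \<Rightarrow> real) \<Rightarrow> ('a \<Rightarrow> real) set" where
  "subdiff_J \<Omega> u = {\<zeta> \<in> L2_space \<Omega>.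
     (\<forall>v\<in>L2_space \<Omega>. ereal (L2_inner \<Omega> \<zeta> v) \<le> J_fun \<Omega> v) \<and> ereal (L2_inner \<Omega> \<zeta> u) = J_fun \<Omega> u}"

definition ground_state :: "'a::euclidean_space set \<Rightarrow> ('a \<Rightarrow> real) \<Rightarrow> bool" where
  "ground_state \<Omega> u \<longleftrightarrow> u \<in> W1inf0 \<Omega> \<and> \<not> ae_zero_on \<Omega> u \<and>
     (\<forall>v\<in>W1inf0 \<Omega>. \<not> ae_zero_on \<Omega> v \<longrightarrow>
        J_fun \<Omega> u / ereal (L2_norm \<Omega> u) \<le> J_fun \<Omega> v / ereal (L2_norm \<Omega> v))"

end

theory Submission
  imports Defs
begin

text \<open>
  Let \<open>D\<close> be the distance to the complement of \<open>\<Omega>\<close>. Every \<open>v\<close> in \<open>W\<^sup>1\<^sup>,\<^sup>\<infinity>\<^sub>0(\<Omega>)\<close> satisfies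
  \<open>\<bar>v\<bar> \<le> J(v) D\<close>, because mollifications of \<open>v\<close> are \<open>J(v)\<close>-Lipschitz along segments inside \<open>\<Omega>\<close>.
  Conversely \<open>D\<close> is a uniform limit of smooth functions with \<open>J \<le> 1\<close> (mollify the positive part of
  \<open>D - \<epsilon>\<close>), which avoids Rademacher's theorem. Testing \<open>l u \<in> \<partial>J(u)\<close> with these functions gives
  \<open>l \<langle>u, D\<rangle> \<le> 1\<close>, while \<open>l \<parallel>u\<parallel>\<^sup>2 = J(u) = L\<close>. Hence \<open>\<langle>u, L D - u\<rangle> \<le> 0\<close>, although \<open>u \<ge> 0\<close> and
  \<open>L D - u \<ge> 0\<close>. So \<open>u\<close> takes only the values \<open>0\<close> and \<open>L D\<close>, and \<open>u = L D\<close> by connectedness.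
  The bound \<open>\<parallel>v\<parallel> \<le> J(v) \<parallel>D\<parallel>\<close> now says that \<open>u\<close> minimises the quotient.
\<close>

section \<open>Smooth test functions supported in boxes\<close>

text \<open>\<Omega> need not be convex, so a gradient bound by J(v) does not make v J(v)-Lipschitz
  on \<Omega>. The bound by D survives because the segment from x to a nearest point of the
  complement runs, up to its end, inside a ball contained in \<Omega>. The bound 1 in the test with
  D is the Lipschitz constant of D. Cutting at \<epsilon> leaves room for a smoothing radius
  \<epsilon>/2, so the smooth functions still vanish on the boundary. The two facts about l combine
  because l <u, L D - u> = L (l <u, D>) - L. Connectedness applies because D > 0 inside \<Omega>, so
  the relatively closed sets u = 0 and u = L D are disjoint there. Two features of the definitions
  shape the development. J measures a gradient picked by choice, so bounding J of an explicit smooth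
  function requires almost everywhere uniqueness of weak gradients. Smoothness is the recursive
  predicate \<open>Ck_fun\<close>, so bumps and kernels are built by hand from exp(-1/x), a family
  that has to be followed through all derivatives.\<close>

text \<open>The parameter \<open>p\<close> makes the family closed under differentiation.\<close>

definition flat_exp :: "real poly \<Rightarrow> real \<Rightarrow> real" where
  "flat_exp p x = (if x > 0 then poly p (1 / x) * exp (- (1 / x)) else 0)"

lemma poly_times_exp_minus_tendsto_0:
  fixes p :: "real poly"
  shows "((\<lambda>y. poly p y * exp (- y)) \<longlongrightarrow> 0) at_top"
proof -
  have "((\<lambda>y. \<Sum>i\<le>degree p. coeff p i * (y ^ i / exp y)) \<longlongrightarrow> (\<Sum>i\<le>degree p. coeff p i * 0)) at_top"
    by (intro tendsto_sum tendsto_mult tendsto_const tendsto_power_div_exp_0)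
  moreover have "poly p y * exp (- y) = (\<Sum>i\<le>degree p. coeff p i * (y ^ i / exp y))" for y
    by (simp add: poly_altdef sum_distrib_right exp_minus divide_inverse mult.assoc)
  ultimately show ?thesis by simp
qed

text \<open>With y = 1/x the derivative of p(y) exp(-y) is y^2 (p(y) - p'(y)) exp(-y), hence the new
  polynomial X^2 (p - p'). At 0 the right difference quotient is y p(y) exp(-y), again a polynomial
  times exp(-y), and tends to 0.\<close>

lemma flat_exp_has_real_derivative:
  "(flat_exp p has_real_derivative flat_exp (monom 1 2 * (p - pderiv p)) x) (at x)"
proof -
  consider "x > 0" | "x < 0" | "x = 0" by linarith
  then show ?thesis
  proof cases
    case 1
    have "((\<lambda>x. poly p (1 / x) * exp (- (1 / x))) has_real_derivative
        flat_exp (monom 1 2 * (p - pderiv p)) x) (at x)"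
      using 1 unfolding flat_exp_def
      by (auto intro!: derivative_eq_intros DERIV_chain2[OF poly_DERIV]
          simp: poly_monom field_simps power2_eq_square)
    moreover have "\<forall>\<^sub>F y in nhds x. flat_exp p y = poly p (1 / y) * exp (- (1 / y))"
      using eventually_nhds_in_open[of "{0<..}" x] 1
      by (auto simp: flat_exp_def elim: eventually_mono)
    ultimately show ?thesis
      by (subst DERIV_cong_ev[OF refl _ refl])
  next
    case 2
    have "\<forall>\<^sub>F y in nhds x. flat_exp p y = 0"
      using eventually_nhds_in_open[of "{..<0}" x] 2
      by (auto simp: flat_exp_def elim: eventually_mono)
    then show ?thesis
      using 2 by (subst DERIV_cong_ev[OF refl _ refl]) (auto simp: flat_exp_def)
  next
    case 3
    have "((\<lambda>h. poly (monom 1 1 * p) (1 / h) * exp (- (1 / h))) \<longlongrightarrow> 0) (at_right 0)"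
      using filterlim_compose[OF poly_times_exp_minus_tendsto_0[of "monom 1 1 * p"] filterlim_inverse_at_top_right]
      by (simp only: inverse_eq_divide)
    then have "((\<lambda>h. flat_exp p h / h) \<longlongrightarrow> 0) (at_right 0)"
      by (rule Lim_transform_eventually)
        (auto simp: flat_exp_def poly_monom eventually_at_filter)
    moreover have "((\<lambda>h. flat_exp p h / h) \<longlongrightarrow> 0) (at_left 0)"
      by (rule Lim_transform_eventually[OF tendsto_const])
        (auto simp: flat_exp_def eventually_at_filter)
    ultimately have "((\<lambda>h. flat_exp p h / h) \<longlongrightarrow> 0) (at 0)"
      by (simp add: filterlim_split_at)
    then show ?thesis
      using 3 by (simp add: DERIV_def flat_exp_def)
  qed
qed

section \<open>Smoothness of affine compositions, sums and products\<close>

lemma frechet_derivative_eqI: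
  "(f has_derivative D) (at x) \<Longrightarrow> frechet_derivative f (at x) = D"
  by (simp add: frechet_derivative_at[symmetric])

lemma Ck_fun_const: "Ck_fun k (\<lambda>x::'a::euclidean_space. c)"
  by (induction k arbitrary: c) (auto simp: frechet_derivative_const)

text \<open>A directional derivative in direction b only changes the data: r becomes
  \<open>r * (b \<bullet> a)\<close> and p becomes X^2 (p - p'). The induction therefore generalises
  over both.\<close>

lemma Ck_fun_flat_exp:
  fixes a :: "'a::euclidean_space"
  shows "Ck_fun k (\<lambda>x. r * flat_exp p (x \<bullet> a + e))"
proof (induction k arbitrary: r p)
  case 0
  have "continuous_on UNIV (flat_exp p)"
    using flat_exp_has_real_derivative DERIV_isCont continuous_at_imp_continuous_on by blast
  then show ?case
    by (auto intro!: continuous_intros continuous_on_compose2[where f="\<lambda>x. x \<bullet> a + e"])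
next
  case (Suc k)
  let ?q = "monom 1 2 * (p - pderiv p)"
  have D: "((\<lambda>x. r * flat_exp p (x \<bullet> a + e)) has_derivative
      (\<lambda>h. (r * (h \<bullet> a)) * flat_exp ?q (x \<bullet> a + e))) (at x)" for x
    by (rule derivative_eq_intros refl
        has_derivative_compose[of "\<lambda>x. x \<bullet> a + e", OF _ flat_exp_has_real_derivative[unfolded has_field_derivative_def]])+
      (simp add: mult_ac)
  then have "frechet_derivative (\<lambda>x. r * flat_exp p (x \<bullet> a + e)) (at x) b
      = (r * (b \<bullet> a)) * flat_exp ?q (x \<bullet> a + e)" for x b
    by (simp add: frechet_derivative_eqI[OF D])
  moreover have "(\<lambda>x. r * flat_exp p (x \<bullet> a + e)) differentiable_on UNIV"
    using D by (auto simp: differentiable_on_def differentiable_def)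
  ultimately show ?case using Suc by simp
qed

lemma Ck_fun_Suc_imp: "Ck_fun (Suc k) f \<Longrightarrow> Ck_fun k f"
proof (induction k arbitrary: f)
  case 0
  then show ?case by (simp add: differentiable_imp_continuous_on)
next
  case (Suc k)
  then show ?case by (metis Ck_fun.simps(2))
qed

lemma Ck_fun_Suc_has_derivative:
  "Ck_fun (Suc k) f \<Longrightarrow> (f has_derivative frechet_derivative f (at x)) (at x)"
  by (simp add: differentiable_on_def frechet_derivative_works)

lemma Ck_fun_add: "Ck_fun k f \<Longrightarrow> Ck_fun k g \<Longrightarrow> Ck_fun k (\<lambda>x. f x + g x)"
proof (induction k arbitrary: f g)
  case 0
  then show ?case by (auto intro: continuous_intros)
next
  case (Suc k)
  have "frechet_derivative (\<lambda>x. f x + g x) (at x) b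
      = frechet_derivative f (at x) b + frechet_derivative g (at x) b" for x b
    by (subst frechet_derivative_eqI[OF has_derivative_add[OF
          Suc.prems[THEN Ck_fun_Suc_has_derivative]]]) simp
  then show ?case using Suc by (simp add: differentiable_on_def)
qed

text \<open>The product rule also contains the undifferentiated factors, known at order k + 1 but
  used at order k; \<open>Ck_fun_Suc_imp\<close> closes this gap.\<close>

lemma Ck_fun_mult: "Ck_fun k f \<Longrightarrow> Ck_fun k g \<Longrightarrow> Ck_fun k (\<lambda>x. f x * g x)"
proof (induction k arbitrary: f g)
  case 0
  then show ?case by (auto intro: continuous_intros)
next
  case (Suc k)
  have "frechet_derivative (\<lambda>x. f x * g x) (at x) b
      = f x * frechet_derivative g (at x) b + frechet_derivative f (at x) b * g x" for x b
    by (subst frechet_derivative_eqI[OF has_derivative_mult[OF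
          Suc.prems[THEN Ck_fun_Suc_has_derivative]]]) simp
  moreover have "Ck_fun k f" "Ck_fun k g"
    using Suc.prems Ck_fun_Suc_imp by blast+
  ultimately show ?case using Suc by (auto simp: differentiable_on_def intro!: Ck_fun_add)
qed

lemma Ck_fun_prod:
  "finite I \<Longrightarrow> (\<And>i. i \<in> I \<Longrightarrow> Ck_fun k (f i)) \<Longrightarrow> Ck_fun k (\<lambda>x. \<Prod>i\<in>I. f i x)"
  by (induction I rule: finite_induct) (auto intro: Ck_fun_mult Ck_fun_const)

text \<open>The parameter j leaves the support unchanged and only sharpens the profile: for t > 0
  the factor \<open>flat_exp 1 (j * t)\<close> is exp(-1/(j t)), which tends to 1. The bumps thus
  approximate the indicator of the open box from inside.\<close>

definition box_bump :: "real \<Rightarrow> 'a \<Rightarrow> 'a \<Rightarrow> 'a::euclidean_space \<Rightarrow> real" where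
  "box_bump j a b x =
     (\<Prod>i\<in>Basis. flat_exp 1 (j * (x \<bullet> i - a \<bullet> i)) * flat_exp 1 (j * (b \<bullet> i - x \<bullet> i)))"

lemma Ck_fun_box_bump: "Ck_fun k (box_bump j a b)"
proof -
  have "Ck_fun k (\<lambda>x. flat_exp 1 (j * (x \<bullet> i - a \<bullet> i)) * flat_exp 1 (j * (b \<bullet> i - x \<bullet> i)))" for i
  proof (rule Ck_fun_mult)
    show "Ck_fun k (\<lambda>x. flat_exp 1 (j * (x \<bullet> i - a \<bullet> i)))"
      using Ck_fun_flat_exp[of k 1 1 "j *\<^sub>R i" "- (j * (a \<bullet> i))"] by (simp add: algebra_simps)
    show "Ck_fun k (\<lambda>x. flat_exp 1 (j * (b \<bullet> i - x \<bullet> i)))"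
      using Ck_fun_flat_exp[of k 1 1 "- (j *\<^sub>R i)" "j * (b \<bullet> i)"] by (simp add: algebra_simps)
  qed
  then show ?thesis unfolding box_bump_def[abs_def] by (intro Ck_fun_prod) auto
qed

lemma flat_exp_1_bounds: "0 \<le> flat_exp 1 x" "flat_exp 1 x \<le> 1"
  by (auto simp: flat_exp_def)

lemma box_bump_nonneg: "0 \<le> box_bump j a b x"
  unfolding box_bump_def by (intro prod_nonneg) (auto intro!: mult_nonneg_nonneg flat_exp_1_bounds)

lemma box_bump_le_1: "box_bump j a b x \<le> 1"
  unfolding box_bump_def by (intro prod_le_1) (auto intro!: mult_nonneg_nonneg mult_le_one flat_exp_1_bounds)

lemma box_bump_pos_iff:
  assumes "j > 0"
  shows "0 < box_bump j a b x \<longleftrightarrow> x \<in> box a b"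
proof -
  have "0 < box_bump j a b x \<longleftrightarrow> box_bump j a b x \<noteq> 0"
    using box_bump_nonneg[of j a b x] by linarith
  also have "\<dots> \<longleftrightarrow> x \<in> box a b"
    using assms by (auto simp: box_bump_def mem_box flat_exp_def zero_less_mult_iff)
  finally show ?thesis .
qed

lemma box_bump_eq_0:
  assumes "j > 0" "x \<notin> box a b"
  shows "box_bump j a b x = 0"
  using box_bump_pos_iff[OF assms(1), of a b x] box_bump_nonneg[of j a b x] assms(2) by linarith

lemma box_bump_tendsto_indicator:
  "(\<lambda>j. box_bump (real (Suc j)) a b x) \<longlonglongrightarrow> indicator (box a b) x"
proof (cases "x \<in> box a b")
  case True
  have *: "(\<lambda>j. flat_exp 1 (real (Suc j) * t)) \<longlonglongrightarrow> 1" if "t > 0" for t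
  proof -
    have "(\<lambda>j. exp (- ((1 / t) * (1 / real (Suc j))))) \<longlonglongrightarrow> exp (- ((1 / t) * 0))"
      by (intro tendsto_intros lim_1_over_n[THEN LIMSEQ_Suc])
    moreover have "flat_exp 1 (real (Suc j) * t) = exp (- ((1 / t) * (1 / real (Suc j))))" for j
      using that by (simp add: flat_exp_def zero_less_mult_iff mult.commute)
    ultimately show ?thesis by simp
  qed
  have "(\<lambda>j. box_bump (real (Suc j)) a b x) \<longlonglongrightarrow> (\<Prod>i\<in>(Basis::'a set). 1 * 1)"
    unfolding box_bump_def
    by (intro tendsto_prod tendsto_mult *) (use True in \<open>auto simp: mem_box\<close>)
  then show ?thesis using True by simp
next
  case False
  then show ?thesis by (simp add: box_bump_eq_0 del: of_nat_Suc)
qed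

lemma mem_test_functionsI:
  assumes "\<And>k. Ck_fun k f" "\<And>x. f x \<noteq> 0 \<Longrightarrow> x \<in> S" "compact S" "S \<subseteq> \<Omega>"
  shows "f \<in> test_functions \<Omega>"
proof -
  have "closure {x. f x \<noteq> 0} \<subseteq> S"
    using assms(2,3) by (intro closure_minimal) (auto simp: compact_imp_closed)
  then show ?thesis
    using assms by (auto simp: test_functions_def compact_closure intro: bounded_subset compact_imp_bounded)
qed

lemma box_bump_test_function:
  assumes "j > 0" "cbox a b \<subseteq> \<Omega>"
  shows "box_bump j a b \<in> test_functions \<Omega>"
proof (rule mem_test_functionsI)
  show "x \<in> cbox a b" if "box_bump j a b x \<noteq> 0" for x
    using that box_bump_eq_0[OF assms(1)] box_subset_cbox[of a b] by blast
qed (auto simp: Ck_fun_box_bump assms)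

section \<open>Integrals of continuous functions with compact support\<close>

text \<open>The exceptional points form an open set, as f is continuous and C closed; a nonempty
  open set is not null. This turns almost everywhere statements about continuous representatives
  into pointwise ones.\<close>

lemma AE_lebesgue_on_open_imp_ball:
  fixes f :: "'a::euclidean_space \<Rightarrow> 'b::topological_space"
  assumes "open S" "continuous_on S f" "closed C" "AE x in lebesgue_on S. f x \<in> C" "x \<in> S"
  shows "f x \<in> C"
proof (rule ccontr)
  assume "f x \<notin> C"
  let ?T = "S \<inter> f -` (- C)"
  have "open ?T"
    using continuous_open_preimage[OF assms(2,1), of "- C"] assms(3) by auto
  moreover have "AE x in lebesgue. x \<in> S \<longrightarrow> f x \<in> C"
    using assms(1,4) by (subst (asm) AE_restrict_space_iff) (auto simp: borel_open)
  then have "AE x in lebesgue. x \<notin> ?T"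
    by eventually_elim auto
  then have "?T \<in> null_sets lebesgue"
    using \<open>open ?T\<close> by (subst (asm) AE_iff_null_sets[symmetric]) (auto simp: borel_open)
  then have "negligible ?T"
    by (simp add: negligible_iff_null_sets)
  ultimately show False
    using open_not_negligible[of ?T] \<open>f x \<notin> C\<close> assms(5) by blast
qed

lemma integral_lborel_shift:
  fixes f :: "'a::euclidean_space \<Rightarrow> real"
  assumes [measurable]: "f \<in> borel_measurable borel"
  shows "integral\<^sup>L lborel (\<lambda>y. f (c + y)) = integral\<^sup>L lborel f"
proof -
  have "integral\<^sup>L lborel f = integral\<^sup>L (distr lborel borel ((+) c)) f"
    by (simp add: lborel_distr_plus)
  then show ?thesis by (simp add: integral_distr)
qed

text \<open>A bridge to the gauge integral over a fixed box, where the Leibniz rule and continuity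
  in a parameter are applied.\<close>

lemma
  fixes f :: "'a::euclidean_space \<Rightarrow> real"
  assumes "continuous_on UNIV f" "\<And>x. x \<notin> cbox a b \<Longrightarrow> f x = 0"
  shows integrable_lborel_compact_support: "integrable lborel f"
    and integral_lborel_compact_support: "integral\<^sup>L lborel f = integral (cbox a b) f"
proof -
  have eq: "(\<lambda>x. indicator (cbox a b) x *\<^sub>R f x) = f"
    using assms(2) by (auto simp: fun_eq_iff indicator_def)
  have "integrable lborel (\<lambda>x. indicator (cbox a b) x *\<^sub>R f x)"
    using assms(1) by (intro borel_integrable_compact) (auto intro: continuous_on_subset)
  then show int: "integrable lborel f" unfolding eq .
  have "integral (cbox a b) f = integral UNIV (\<lambda>x. if x \<in> cbox a b then f x else 0)"
    by (simp only: integral_restrict_UNIV)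
  also have "(\<lambda>x. if x \<in> cbox a b then f x else 0) = f"
    using assms(2) by auto
  finally show "integral\<^sup>L lborel f = integral (cbox a b) f"
    using integral_lborel[OF int] by simp
qed

lemma integral_lebesgue_on_eq_lborel:
  fixes f :: "'a::euclidean_space \<Rightarrow> real"
  assumes "open S" "f \<in> borel_measurable borel" "\<And>x. x \<notin> S \<Longrightarrow> f x = 0"
  shows "integral\<^sup>L (lebesgue_on S) f = integral\<^sup>L lborel f"
proof -
  have "integral\<^sup>L (lebesgue_on S) f = integral\<^sup>L lebesgue (\<lambda>x. indicator S x *\<^sub>R f x)"
    using assms(1) by (intro integral_restrict_space) (auto simp: borel_open)
  also have "(\<lambda>x. indicator S x *\<^sub>R f x) = f"
    using assms(3) by (auto simp: fun_eq_iff indicator_def)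
  finally show ?thesis
    using assms(2) by (simp add: integral_completion)
qed

text \<open>Only parameters near 0 matter for a derivative at 0. Restricting the support condition
  to \<open>\<bar>t\<bar> \<le> 1\<close> lets the support of \<open>f t\<close> move with t while a
  single box still contains it.\<close>

lemma DERIV_integral_lborel:
  fixes f f' :: "real \<Rightarrow> 'a::euclidean_space \<Rightarrow> real"
  assumes deriv: "\<And>t y. ((\<lambda>t. f t y) has_real_derivative f' t y) (at t)"
    and cont_f: "\<And>t. continuous_on UNIV (f t)"
    and cont_f': "continuous_on UNIV (\<lambda>(t, y). f' t y)"
    and supp_f: "\<And>t y. \<bar>t\<bar> \<le> 1 \<Longrightarrow> y \<notin> cbox a b \<Longrightarrow> f t y = 0"
    and supp_f': "\<And>y. y \<notin> cbox a b \<Longrightarrow> f' 0 y = 0"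
  shows "((\<lambda>t. integral\<^sup>L lborel (f t)) has_real_derivative integral\<^sup>L lborel (f' 0)) (at 0)"
proof -
  \<comment> \<open>A convex parameter set for the Leibniz rule with 0 in its interior, so the
    one-set derivative is a full derivative.\<close>
  let ?U = "{-1..1::real}"
  have "((\<lambda>t. integral (cbox a b) (f t)) has_field_derivative integral (cbox a b) (f' 0)) (at 0 within ?U)"
  proof (rule leibniz_rule_field_derivative)
    show "f t integrable_on cbox a b" for t
      by (rule integrable_continuous) (use cont_f in \<open>auto intro: continuous_on_subset\<close>)
  qed (use deriv cont_f' in \<open>auto intro: has_field_derivative_at_within continuous_on_subset\<close>)
  moreover have "at (0::real) within ?U = at 0"
    by (rule at_within_interior) auto
  moreover have "\<forall>\<^sub>F t in nhds 0. integral\<^sup>L lborel (f t) = integral (cbox a b) (f t)"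
  proof -
    have "\<forall>\<^sub>F t in nhds 0. t \<in> {-1<..<1::real}"
      by (rule eventually_nhds_in_open) auto
    then show ?thesis
      by eventually_elim (auto intro!: integral_lborel_compact_support cont_f supp_f)
  qed
  moreover have "continuous_on UNIV (f' 0)"
    using continuous_on_compose2[OF cont_f', of UNIV "\<lambda>y. (0, y)"]
    by (simp add: continuous_on_Pair continuous_on_id)
  then have "integral\<^sup>L lborel (f' 0) = integral (cbox a b) (f' 0)"
    by (intro integral_lborel_compact_support supp_f')
  ultimately show ?thesis
    by (subst DERIV_cong_ev[OF refl _ refl]) auto
qed

text \<open>By translation invariance the integral of F(x + t h) is constant in t, and its
  derivative at 0 is the integral of G. This replaces integration by parts with boundary
  terms.\<close>

lemma integral_directional_derivative_eq_0:
  fixes F G :: "'a::euclidean_space \<Rightarrow> real"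
  assumes deriv: "\<And>x. ((\<lambda>t. F (x + t *\<^sub>R h)) has_real_derivative G x) (at 0)"
    and cont: "continuous_on UNIV F" "continuous_on UNIV G"
    and supp: "\<And>x. norm x > R \<Longrightarrow> F x = 0" "\<And>x. norm x > R \<Longrightarrow> G x = 0"
  shows "integral\<^sup>L lborel G = 0"
proof -
  \<comment> \<open>Translating by t h with |t| <= 1 moves the support by at most |h|, hence the
    radius R + |h|.\<close>
  obtain c where c: "cball 0 (R + norm h) \<subseteq> cbox (- c) (c::'a)"
    using bounded_subset_cbox_symmetric[OF bounded_cball] by metis
  have "((\<lambda>t. integral\<^sup>L lborel (\<lambda>x. F (x + t *\<^sub>R h))) has_real_derivative
      integral\<^sup>L lborel (\<lambda>x. G (x + 0 *\<^sub>R h))) (at 0)"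
  proof (rule DERIV_integral_lborel[where f="\<lambda>t x. F (x + t *\<^sub>R h)" and f'="\<lambda>t x. G (x + t *\<^sub>R h)"
        and a="-c" and b=c])
    show "((\<lambda>t. F (x + t *\<^sub>R h)) has_real_derivative G (x + t *\<^sub>R h)) (at t)" for t x
      using deriv[of "x + t *\<^sub>R h"] DERIV_shift[of "\<lambda>t. F (x + t *\<^sub>R h)" _ 0 t]
      by (simp add: algebra_simps)
  next
    fix t :: real and y :: 'a assume "\<bar>t\<bar> \<le> 1" "y \<notin> cbox (- c) c"
    then have "norm y > R + norm h" using c by force
    moreover have "norm (t *\<^sub>R h) \<le> norm h"
      using \<open>\<bar>t\<bar> \<le> 1\<close> by (simp add: mult_left_le_one_le)
    moreover have "norm y \<le> norm (y + t *\<^sub>R h) + norm (t *\<^sub>R h)"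
      by (metis add_diff_cancel norm_triangle_ineq4)
    ultimately show "F (y + t *\<^sub>R h) = 0" by (intro supp) linarith
  next
    fix y :: 'a assume "y \<notin> cbox (- c) c"
    then have "norm y > R + norm h" using c by force
    then show "G (y + 0 *\<^sub>R h) = 0"
      by (simp add: supp(2) order.strict_trans1[OF _ \<open>norm y > _\<close>])
  qed (auto intro!: continuous_intros continuous_on_compose2[OF cont(1)] continuous_on_compose2[OF cont(2)]
       simp: split_beta)
  moreover have "F \<in> borel_measurable borel"
    using cont(1) by (rule borel_measurable_continuous_onI)
  then have "integral\<^sup>L lborel (\<lambda>x. F (x + t *\<^sub>R h)) = integral\<^sup>L lborel F" for t
    using integral_lborel_shift[of F "t *\<^sub>R h"] by (simp add: add.commute)
  ultimately show ?thesis
    using DERIV_unique[of "\<lambda>_. integral\<^sup>L lborel F" _ 0 0] by simp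
qed

section \<open>Directional derivatives of smooth functions\<close>

lemma frechet_derivative_sum_Basis:
  fixes f :: "'a::euclidean_space \<Rightarrow> real"
  assumes "Ck_fun (Suc k) f"
  shows "frechet_derivative f (at x) h = (\<Sum>b\<in>Basis. (h \<bullet> b) * frechet_derivative f (at x) b)"
proof -
  interpret bounded_linear "frechet_derivative f (at x)"
    using Ck_fun_Suc_has_derivative[OF assms] by (rule has_derivative_bounded_linear)
  have "frechet_derivative f (at x) h = frechet_derivative f (at x) (\<Sum>b\<in>Basis. (h \<bullet> b) *\<^sub>R b)"
    by (simp add: euclidean_representation)
  then show ?thesis by (simp add: sum scaleR)
qed

lemma continuous_frechet_derivative:
  fixes f :: "'a::euclidean_space \<Rightarrow> real"
  assumes "Ck_fun (Suc k) f"
  shows "continuous_on UNIV (\<lambda>x. frechet_derivative f (at x) h)"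
proof -
  have "Ck_fun (Suc 0) f"
    using assms by (induction k) (auto simp del: Ck_fun.simps dest: Ck_fun_Suc_imp)
  then show ?thesis
    by (subst frechet_derivative_sum_Basis[OF assms]) (auto intro!: continuous_intros)
qed

lemma Ck_fun_directional_derivative:
  assumes "Ck_fun (Suc k) f"
  shows "((\<lambda>t. f (x + t *\<^sub>R h)) has_real_derivative frechet_derivative f (at x) h) (at 0)"
proof -
  have "(f has_derivative frechet_derivative f (at (x + 0 *\<^sub>R h))) (at (x + 0 *\<^sub>R h))"
    by (rule Ck_fun_Suc_has_derivative[OF assms])
  then have "((\<lambda>t. f (x + t *\<^sub>R h)) has_derivative
      (\<lambda>s. frechet_derivative f (at (x + 0 *\<^sub>R h)) (s *\<^sub>R h))) (at 0)"
    by (rule has_derivative_compose[rotated, where f="\<lambda>t. x + t *\<^sub>R h"]) (auto intro!: derivative_eq_intros)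
  moreover have "frechet_derivative f (at x) (s *\<^sub>R h) = frechet_derivative f (at x) h * s" for s
    using linear_scale[OF has_derivative_linear[OF Ck_fun_Suc_has_derivative[OF assms]]]
    by (simp add: mult.commute)
  ultimately show ?thesis
    by (simp add: has_field_derivative_def mult_commute_abs)
qed

lemma frechet_derivative_eq_0_outside:
  fixes f :: "'a::euclidean_space \<Rightarrow> real"
  assumes "open U" "x \<in> U" "\<And>y. y \<in> U \<Longrightarrow> f y = 0"
  shows "frechet_derivative f (at x) = (\<lambda>_. 0)"
proof (rule frechet_derivative_eqI)
  have "((\<lambda>_. 0) has_derivative (\<lambda>_. 0)) (at x)" by simp
  then show "(f has_derivative (\<lambda>_. 0)) (at x)"
    by (rule has_derivative_transform_within_open[OF _ assms(1,2)]) (simp add: assms(3))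
qed

section \<open>Mollification\<close>

definition smoothing_kernel :: "real \<Rightarrow> ('a::euclidean_space \<Rightarrow> real) \<Rightarrow> bool" where
  "smoothing_kernel d K \<longleftrightarrow> (\<forall>k. Ck_fun k K) \<and> (\<forall>z. 0 \<le> K z) \<and>
     (\<forall>z. norm z > d \<longrightarrow> K z = 0) \<and> integral\<^sup>L lborel K = 1"

lemma Ck_fun_continuous: "Ck_fun k f \<Longrightarrow> continuous_on UNIV f"
  by (cases k) (auto intro: differentiable_imp_continuous_on)

lemma smoothing_kernel_exists:
  assumes "d > 0"
  shows "\<exists>K :: 'a::euclidean_space \<Rightarrow> real. smoothing_kernel d K"
proof -
  \<comment> \<open>On the cube of half side c the Euclidean norm is at most the l1 norm, which is
    at most DIM times c, that is d.\<close>
  define c where "c = d / real DIM('a)"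
  have "c > 0" using assms by (simp add: c_def)
  define P where "P = box_bump 1 (- (c *\<^sub>R One)) (c *\<^sub>R One :: 'a)"
  have cont: "continuous_on UNIV P"
    unfolding P_def by (rule Ck_fun_continuous[OF Ck_fun_box_bump[of 0]])
  have out: "P z = 0" if "z \<notin> box (- (c *\<^sub>R One)) (c *\<^sub>R One)" for z
    using that by (simp add: P_def box_bump_eq_0)
  have supp: "P z = 0" if "norm z > d" for z
  proof (rule out, rule notI)
    assume "z \<in> box (- (c *\<^sub>R One)) (c *\<^sub>R One)"
    then have "\<bar>z \<bullet> i\<bar> \<le> c" if "i \<in> Basis" for i
      using that by (force simp: mem_box abs_le_iff)
    then have "norm z \<le> (\<Sum>i\<in>(Basis::'a set). c)"
      by (intro order.trans[OF norm_le_l1] sum_mono) auto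
    then show False using that by (simp add: c_def)
  qed
  have int: "integrable lborel P"
    by (rule integrable_lborel_compact_support[OF cont, of "- (c *\<^sub>R One)" "c *\<^sub>R One"])
      (use out box_subset_cbox in blast)
  have "integral\<^sup>L lborel P \<noteq> 0"
  proof
    assume "integral\<^sup>L lborel P = 0"
    then have "AE x in lborel. P x = 0"
      using int by (subst (asm) integral_nonneg_eq_0_iff_AE) (auto simp: P_def box_bump_nonneg)
    then have "AE x in lebesgue_on UNIV. P x \<in> {0}"
      by (simp only: lebesgue_on_UNIV_eq AE_completion singleton_iff)
    then have "P 0 \<in> {0}"
      by (intro AE_lebesgue_on_open_imp_ball[OF _ cont]) auto
    moreover have "(0::'a) \<in> box (- (c *\<^sub>R One)) (c *\<^sub>R One)"
      using \<open>c > 0\<close> by (simp add: mem_box)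
    then have "P 0 > 0" by (simp add: P_def box_bump_pos_iff)
    ultimately show False by simp
  qed
  moreover have "integral\<^sup>L lborel P \<ge> 0"
    by (intro integral_nonneg_AE) (simp add: P_def box_bump_nonneg)
  moreover have "Ck_fun k (\<lambda>z. P z * inverse (integral\<^sup>L lborel P))" for k
    unfolding P_def by (intro Ck_fun_mult Ck_fun_box_bump Ck_fun_const)
  ultimately have "smoothing_kernel d (\<lambda>z. P z * inverse (integral\<^sup>L lborel P))"
    using supp by (simp add: smoothing_kernel_def P_def box_bump_nonneg)
  then show ?thesis by blast
qed

definition mollify :: "('a::euclidean_space \<Rightarrow> real) \<Rightarrow> ('a \<Rightarrow> real) \<Rightarrow> 'a \<Rightarrow> real" where
  "mollify K W x = integral\<^sup>L lborel (\<lambda>y. W y * K (y - x))"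

text \<open>The minus sign comes from the kernel argument y - x: the derivative in x is minus the
  derivative of K. With this convention the kernel centred at x is just a translate of K.\<close>

definition mollify_deriv :: "('a::euclidean_space \<Rightarrow> real) \<Rightarrow> ('a \<Rightarrow> real) \<Rightarrow> 'a \<Rightarrow> 'a \<Rightarrow> real" where
  "mollify_deriv K W x h = - integral\<^sup>L lborel (\<lambda>y. W y * frechet_derivative K (at (y - x)) h)"

context
  fixes K :: "'a::euclidean_space \<Rightarrow> real" and d :: real
  assumes K: "smoothing_kernel d K"
begin

lemma kernel_cont: "continuous_on UNIV K"
  using K Ck_fun_continuous by (auto simp: smoothing_kernel_def)

lemma kernel_nonneg: "0 \<le> K z" and kernel_eq_0: "norm z > d \<Longrightarrow> K z = 0"
  and kernel_Ck: "Ck_fun k K" and kernel_integral: "integral\<^sup>L lborel K = 1"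
  using K by (auto simp: smoothing_kernel_def)

lemma kernel_box: "\<exists>c::'a. \<forall>z. z \<notin> cbox (- c) c \<longrightarrow> norm z > d"
proof -
  obtain c where "cball 0 d \<subseteq> cbox (- c) (c::'a)"
    using bounded_subset_cbox_symmetric[OF bounded_cball] by metis
  then show ?thesis
    by (meson mem_cball_0 not_le_imp_less subset_iff)
qed

lemma kernel_integrable:
  assumes "continuous_on UNIV W"
  shows "integrable lborel (\<lambda>z. W z * K z)"
proof -
  obtain c :: 'a where "\<forall>z. z \<notin> cbox (- c) c \<longrightarrow> norm z > d"
    using kernel_box by blast
  then have "W z * K z = 0" if "z \<notin> cbox (- c) c" for z
    using that kernel_eq_0[of z] by simp
  moreover have "continuous_on UNIV (\<lambda>z. W z * K z)"
    using assms kernel_cont by (rule continuous_on_mult)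
  ultimately show ?thesis
    by (rule integrable_lborel_compact_support[rotated])
qed

text \<open>The two forms have separate uses: with x inside K the derivative falls on the kernel,
  with x inside W bounds on W pass to the average.\<close>

lemma mollify_shift:
  assumes "continuous_on UNIV W"
  shows "mollify K W x = integral\<^sup>L lborel (\<lambda>z. W (x + z) * K z)"
proof -
  have "(\<lambda>y. W y * K (y - x)) \<in> borel_measurable borel"
    by (intro borel_measurable_continuous_onI continuous_intros assms continuous_on_compose2[OF kernel_cont]) auto
  from integral_lborel_shift[OF this, of x] show ?thesis
    by (simp add: mollify_def)
qed

text \<open>Averaging against a nonnegative kernel of mass one preserves bounds valid on its
  support. Two functions and two centres cover both later uses: a constant V gives the approximation
  error, V = W at a shifted centre gives difference quotients.\<close>

lemma mollify_diff_le:
  assumes "continuous_on UNIV W" "continuous_on UNIV V"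
    and "\<And>z. norm z \<le> d \<Longrightarrow> \<bar>W (x + z) - V (y + z)\<bar> \<le> e"
  shows "\<bar>mollify K W x - mollify K V y\<bar> \<le> e"
proof -
  have c: "continuous_on UNIV (\<lambda>z. W (x + z))" "continuous_on UNIV (\<lambda>z. V (y + z))"
    by (auto intro!: continuous_intros continuous_on_compose2[OF assms(1)] continuous_on_compose2[OF assms(2)])
  note i = c[THEN kernel_integrable]
  have "mollify K W x - mollify K V y = integral\<^sup>L lborel (\<lambda>z. W (x + z) * K z - V (y + z) * K z)"
    by (simp add: mollify_shift assms i)
  also have "\<bar>\<dots>\<bar> \<le> integral\<^sup>L lborel (\<lambda>z. \<bar>W (x + z) * K z - V (y + z) * K z\<bar>)"
    by (rule integral_abs_bound)
  also have "\<dots> \<le> integral\<^sup>L lborel (\<lambda>z. e * K z)"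
  proof (rule integral_mono)
    show "integrable lborel (\<lambda>z. \<bar>W (x + z) * K z - V (y + z) * K z\<bar>)"
      by (intro integrable_abs Bochner_Integration.integrable_diff i)
    show "integrable lborel (\<lambda>z. e * K z)"
      by (rule kernel_integrable) auto
    show "\<bar>W (x + z) * K z - V (y + z) * K z\<bar> \<le> e * K z" for z
    proof (cases "norm z \<le> d")
      case True
      have "\<bar>W (x + z) * K z - V (y + z) * K z\<bar> = \<bar>W (x + z) - V (y + z)\<bar> * K z"
        by (simp add: left_diff_distrib[symmetric] abs_mult kernel_nonneg)
      then show ?thesis
        using assms(3)[OF True] by (simp add: mult_right_mono kernel_nonneg)
    qed (simp add: kernel_eq_0)
  qed
  also have "\<dots> = e"
    by (simp add: kernel_integral)
  finally show ?thesis .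
qed

lemma mollify_const: "mollify K (\<lambda>_. c) x = c"
  by (simp add: mollify_shift kernel_integral)

lemma mollify_approx:
  assumes "continuous_on UNIV W" "\<And>z. norm z \<le> d \<Longrightarrow> \<bar>W (x + z) - c\<bar> \<le> e"
  shows "\<bar>mollify K W x - c\<bar> \<le> e"
  using mollify_diff_le[where V="\<lambda>_. c" and y=x] assms by (simp add: mollify_const)

lemma kernel_deriv_cont: "continuous_on UNIV (\<lambda>z. frechet_derivative K (at z) h)"
  using continuous_frechet_derivative[OF kernel_Ck] .

context
  fixes W :: "'a \<Rightarrow> real" and a b :: 'a
  assumes W_continuous: "continuous_on UNIV W"
    and W_support: "\<forall>x. x \<notin> cbox a b \<longrightarrow> W x = 0"
begin

lemma mollify_deriv_integrable:
  "integrable lborel (\<lambda>y. W y * frechet_derivative K (at (y - x)) h)"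
  by (rule integrable_lborel_compact_support[of _ a b])
    (auto intro!: continuous_intros W_continuous W_support[rule_format] continuous_on_compose2[OF kernel_deriv_cont])

text \<open>As W is only continuous, the derivative is taken on the kernel. The compact support of W
  provides a box of integration that does not depend on t.\<close>

lemma mollify_directional_derivative:
  "((\<lambda>t. mollify K W (x + t *\<^sub>R h)) has_real_derivative mollify_deriv K W x h) (at 0)"
proof -
  let ?f = "\<lambda>t y. W y * K (y - (x + t *\<^sub>R h))"
  let ?f' = "\<lambda>t y. - (W y * frechet_derivative K (at (y - (x + t *\<^sub>R h))) h)"
  have "((\<lambda>t. integral\<^sup>L lborel (?f t)) has_real_derivative integral\<^sup>L lborel (?f' 0)) (at 0)"
  proof (rule DERIV_integral_lborel[where a=a and b=b])
    fix t y
    have "((\<lambda>s. K (y - (x + t *\<^sub>R h) + s *\<^sub>R h)) has_real_derivative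
        frechet_derivative K (at (y - (x + t *\<^sub>R h))) h) (at (- 0))"
      using Ck_fun_directional_derivative[OF kernel_Ck] by simp
    then have "((\<lambda>s. K (y - (x + t *\<^sub>R h) + (- s) *\<^sub>R h)) has_real_derivative
        - frechet_derivative K (at (y - (x + t *\<^sub>R h))) h) (at 0)"
      by (subst (asm) DERIV_mirror)
    then have "((\<lambda>s. K (y - (x + s *\<^sub>R h))) has_real_derivative
        - frechet_derivative K (at (y - (x + t *\<^sub>R h))) h) (at t)"
      using DERIV_shift[of "\<lambda>s. K (y - (x + s *\<^sub>R h))" _ 0 t] by (simp add: algebra_simps)
    from DERIV_cmult[OF this, of "W y"]
    show "((\<lambda>t. ?f t y) has_real_derivative ?f' t y) (at t)" by simp
  next
    show "continuous_on UNIV (\<lambda>(t, y). ?f' t y)"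
      by (auto intro!: continuous_intros continuous_on_compose2[OF W_continuous]
          continuous_on_compose2[OF kernel_deriv_cont] simp: split_beta)
  qed (auto intro!: continuous_intros W_continuous W_support[rule_format] continuous_on_compose2[OF kernel_cont])
  then show ?thesis by (simp add: mollify_def mollify_deriv_def)
qed

lemma continuous_mollify_deriv: "continuous_on UNIV (\<lambda>x. mollify_deriv K W x h)"
proof -
  have "integral\<^sup>L lborel (\<lambda>y. W y * frechet_derivative K (at (y - x)) h)
      = integral (cbox a b) (\<lambda>y. W y * frechet_derivative K (at (y - x)) h)" for x
    by (rule integral_lborel_compact_support)
      (auto intro!: continuous_intros W_continuous W_support[rule_format] continuous_on_compose2[OF kernel_deriv_cont])
  moreover have "continuous_on UNIV (\<lambda>x. integral (cbox a b) (\<lambda>y. W y * frechet_derivative K (at (y - x)) h))"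
    by (rule integral_continuous_on_param)
      (auto intro!: continuous_intros continuous_on_compose2[OF W_continuous]
          continuous_on_compose2[OF kernel_deriv_cont] simp: split_beta)
  ultimately show ?thesis by (simp add: mollify_deriv_def continuous_on_minus)
qed

lemma continuous_mollify: "continuous_on UNIV (mollify K W)"
proof -
  have "mollify K W x = integral (cbox a b) (\<lambda>y. W y * K (y - x))" for x
    unfolding mollify_def
    by (rule integral_lborel_compact_support)
      (auto intro!: continuous_intros W_continuous W_support[rule_format] continuous_on_compose2[OF kernel_cont])
  moreover have "continuous_on UNIV (\<lambda>x. integral (cbox a b) (\<lambda>y. W y * K (y - x)))"
    by (rule integral_continuous_on_param)
      (auto intro!: continuous_intros continuous_on_compose2[OF W_continuous]
          continuous_on_compose2[OF kernel_cont] simp: split_beta)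
  ultimately show ?thesis by presburger
qed

lemma mollify_deriv_sum_Basis: "mollify_deriv K W x h = (\<Sum>i\<in>Basis. (h \<bullet> i) * mollify_deriv K W x i)"
proof -
  have "mollify_deriv K W x h = - integral\<^sup>L lborel
      (\<lambda>y. \<Sum>i\<in>Basis. (h \<bullet> i) * (W y * frechet_derivative K (at (y - x)) i))"
    unfolding mollify_deriv_def
    by (subst frechet_derivative_sum_Basis[OF kernel_Ck, of _ h]) (simp add: sum_distrib_left mult_ac)
  also have "\<dots> = - (\<Sum>i\<in>Basis. (h \<bullet> i) * integral\<^sup>L lborel (\<lambda>y. W y * frechet_derivative K (at (y - x)) i))"
    by (subst Bochner_Integration.integral_sum) (auto intro!: mollify_deriv_integrable)
  finally show ?thesis by (simp add: mollify_deriv_def sum_negf)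
qed

end

end

section \<open>Uniqueness of weak gradients\<close>

text \<open>A Lindelof covering by boxes whose closures stay inside S. It reduces questions on S to
  compact subsets, where weak gradients are integrable, at the cost of a countable union.\<close>

lemma open_countable_Union_box:
  fixes S :: "'a::euclidean_space set"
  assumes "open S"
  obtains C where "countable C" "\<And>X. X \<in> C \<Longrightarrow> \<exists>a b. X = box a b \<and> cbox a b \<subseteq> S" "\<Union>C = S"
proof -
  let ?F = "{X. \<exists>a b. X = box a b \<and> cbox a b \<subseteq> S}"
  obtain C where C: "C \<subseteq> ?F" "countable C" "\<Union>C = \<Union>?F"
    using Lindelof[of ?F] by (auto simp: open_box)
  have "x \<in> \<Union>?F" if x: "x \<in> S" for x
  proof -
    obtain a b where "x \<in> box a b" "cbox a b \<subseteq> S"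
      by (rule open_contains_cbox[OF assms x])
    then show ?thesis by blast
  qed
  then have "\<Union>?F = S"
    using box_subset_cbox by blast
  with C have "\<Union>C = S" by simp
  moreover have "\<exists>a b. X = box a b \<and> cbox a b \<subseteq> S" if "X \<in> C" for X
    using C(1) that by blast
  ultimately show ?thesis
    using C(2) that by blast
qed

text \<open>\<open>has_weak_gradient\<close> controls the gradient on compact subsets only; global
  measurability is glued from countably many boxes.\<close>

lemma measurable_lebesgue_on_open:
  fixes g :: "'a::euclidean_space \<Rightarrow> 'b::topological_space"
  assumes "open S" "\<And>a b. cbox a b \<subseteq> S \<Longrightarrow> g \<in> borel_measurable (lebesgue_on (cbox a b))"
  shows "g \<in> borel_measurable (lebesgue_on S)"
proof -
  obtain C where C: "countable C" "\<And>X. X \<in> C \<Longrightarrow> \<exists>a b. X = box a b \<and> cbox a b \<subseteq> S" "\<Union>C = S"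
    using open_countable_Union_box[OF assms(1)] by blast
  show ?thesis
  proof (rule measurable_piecewise_restrict[OF C(1)])
    fix X assume "X \<in> C"
    then obtain a b where X: "X = box a b" "cbox a b \<subseteq> S" using C(2) by blast
    have sub: "X \<subseteq> S" "X \<subseteq> cbox a b" using X box_subset_cbox by blast+
    have leb: "X \<in> sets lebesgue" "S \<in> sets lebesgue"
      using X assms(1) by (auto simp: borel_open)
    show "X \<inter> space (lebesgue_on S) \<in> sets (lebesgue_on S)"
      using leb sub by (auto simp: sets_restrict_space_iff)
    have "g \<in> borel_measurable (lebesgue_on X)"
      by (rule measurable_restrict_mono[OF assms(2)[OF X(2)] sub(2)])
    then show "g \<in> borel_measurable (restrict_space (lebesgue_on S) X)"
      using leb sub by (simp add: restrict_restrict_space Int_absorb1)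
  qed (use C(3) in auto)
qed

lemma AE_lebesgue_on_open:
  fixes S :: "'a::euclidean_space set"
  assumes "open S" "\<And>a b. cbox a b \<subseteq> S \<Longrightarrow> AE x in lebesgue. x \<in> box a b \<longrightarrow> P x"
  shows "AE x in lebesgue_on S. P x"
proof -
  obtain C where C: "countable C" "\<And>X. X \<in> C \<Longrightarrow> \<exists>a b. X = box a b \<and> cbox a b \<subseteq> S" "\<Union>C = S"
    using open_countable_Union_box[OF assms(1)] by blast
  have "AE x in lebesgue. \<forall>X\<in>C. x \<in> X \<longrightarrow> P x"
    using C(1,2) assms(2) by (subst AE_ball_countable) auto
  then have "AE x in lebesgue. x \<in> S \<longrightarrow> P x"
    by eventually_elim (use C(3) in auto)
  then show ?thesis
    using assms(1) by (subst AE_restrict_space_iff) (auto simp: borel_open)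
qed

text \<open>A Dynkin argument: open boxes are stable under intersection and generate the Borel sets,
  and vanishing of the set integral passes to complements and disjoint unions. A density with zero
  integral over every Borel set is zero almost everywhere. The Borel version h' makes this run over
  \<open>lborel\<close>.\<close>

lemma AE_eq_0_if_box_integrals_eq_0:
  fixes h :: "'a::euclidean_space \<Rightarrow> real"
  assumes int: "integrable lebesgue h"
    and box: "\<And>a b. integral\<^sup>L lebesgue (\<lambda>x. indicator (box a b) x * h x) = 0"
    and supp: "\<And>x. x \<notin> box c d \<Longrightarrow> h x = 0"
  shows "AE x in lebesgue. h x = 0"
proof -
  obtain h' where h': "h' \<in> borel_measurable lborel" "AE x in lborel. h x = h' x"
    using completion_ex_borel_measurable_real[of h lborel] int by auto
  note [measurable] = h'(1)
  have ae: "AE x in lebesgue. h x = h' x"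
    using h'(2) by (rule AE_completion)
  have meas: "h \<in> borel_measurable lebesgue" using int by auto
  have meas': "h' \<in> borel_measurable lebesgue"
    using h'(1) by (rule measurable_completion)
  have int': "integrable lborel h'"
    using integrable_cong_AE[OF meas meas' ae] int integrable_completion[OF h'(1)] by blast
  have eq: "(LINT x:A|lborel. h' x) = integral\<^sup>L lebesgue (\<lambda>x. indicator A x * h x)" if "A \<in> sets borel" for A
  proof -
    have "(LINT x:A|lborel. h' x) = integral\<^sup>L lebesgue (\<lambda>x. indicator A x * h' x)"
      using that by (simp add: set_lebesgue_integral_def integral_completion)
    also have "\<dots> = integral\<^sup>L lebesgue (\<lambda>x. indicator A x * h x)"
    proof (rule integral_cong_AE)
      have ind: "indicator A \<in> borel_measurable lebesgue"
        using that by (intro borel_measurable_indicator) simp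
      show "(\<lambda>x. indicator A x * h' x) \<in> borel_measurable lebesgue"
        by (rule borel_measurable_times[OF ind meas'])
      show "(\<lambda>x. indicator A x * h x) \<in> borel_measurable lebesgue"
        by (rule borel_measurable_times[OF ind meas])
      show "AE x in lebesgue. indicator A x * h' x = indicator A x * h x"
        using ae by eventually_elim simp
    qed
    finally show ?thesis .
  qed
  have set_int: "set_integrable lborel A h'" if "A \<in> sets borel" for A
    using int' that unfolding set_integrable_def by (intro integrable_mult_indicator) auto
  \<comment> \<open>The complement step requires a zero total integral. Since h vanishes outside
    \<open>box c d\<close>, the total is the integral over that one box.\<close>
  have UN: "(LINT x:UNIV|lborel. h' x) = 0"
  proof -
    have "(\<lambda>x. indicator UNIV x * h x) = (\<lambda>x. indicator (box c d) x * h x)"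
      using supp by (auto simp: fun_eq_iff indicator_def)
    then have "integral\<^sup>L lebesgue (\<lambda>x. indicator UNIV x * h x) = 0"
      using box[of c d] by (simp only:)
    then show ?thesis
      using trans[OF eq[OF space_in_borel]] by blast
  qed
  have zero: "(LINT x:A|lborel. h' x) = 0" if "A \<in> sets borel" for A
  proof -
    let ?G = "range (\<lambda>(a, b). box a b) :: 'a set set"
    have sets_eq: "sets borel = sigma_sets UNIV ?G"
      by (subst borel_eq_box) (rule sets_measure_of, simp)
    have "Int_stable ?G"
    proof (rule Int_stableI)
      fix X Y :: "'a set" assume "X \<in> ?G" "Y \<in> ?G"
      then obtain a b a' b' where "X = box a b" "Y = box a' b'" by auto
      then have "X \<inter> Y = box (\<Sum>i\<in>Basis. max (a \<bullet> i) (a' \<bullet> i) *\<^sub>R i) (\<Sum>i\<in>Basis. min (b \<bullet> i) (b' \<bullet> i) *\<^sub>R i)"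
        by (auto simp: mem_box)
      then show "X \<inter> Y \<in> ?G" by auto
    qed
    moreover have "?G \<subseteq> Pow UNIV" by simp
    moreover have "A \<in> sigma_sets UNIV ?G"
      using that unfolding sets_eq .
    ultimately show ?thesis
    proof (induction rule: sigma_sets_induct_disjoint)
      case (basic X)
      then obtain a b where "X = box a b" by auto
      moreover have "(LINT x:box a b|lborel. h' x) = 0"
        using eq[OF borel_open[OF open_box]] box by (rule trans)
      ultimately show ?case by (simp only:)
    next
      case empty
      show ?case unfolding set_lebesgue_integral_def by simp
    next
      case (compl X)
      then have X: "X \<in> sets borel" unfolding sets_eq by blast
      have "(LINT x:X \<union> (UNIV - X)|lborel. h' x) = (LINT x:X|lborel. h' x) + (LINT x:UNIV - X|lborel. h' x)"
        using X by (intro set_integral_Un set_int) auto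
      moreover have "X \<union> (UNIV - X) = UNIV" by blast
      ultimately show ?case using UN compl(2) by simp
    next
      case (union A)
      have A: "A i \<in> sets borel" for i
        using union(2) unfolding sets_eq by blast
      have "(LINT x:(\<Union>i. A i)|lborel. h' x) = (\<Sum>i. (LINT x:A i|lborel. h' x))"
        using union(1) A
        by (intro lebesgue_integral_countable_add set_int) (auto simp: disjoint_family_on_def)
      then show ?case using union(3) by simp
    qed
  qed
  have "AE x in lborel. h' x = 0"
    by (rule sigma_finite_measure.density_zero[OF sigma_finite_lborel int']) (use zero in auto)
  with h'(2) have "AE x in lborel. h x = 0" by eventually_elim simp
  then show ?thesis by (rule AE_completion)
qed

section \<open>Weak gradients: measurability and integrals against test functions\<close>

lemma has_weak_gradient_measurable:
  fixes g :: "'a::euclidean_space \<Rightarrow> 'a"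
  assumes "open S" "has_weak_gradient S u g"
  shows "g \<in> borel_measurable (lebesgue_on S)"
proof (rule measurable_lebesgue_on_open[OF assms(1)])
  fix a b :: 'a assume "cbox a b \<subseteq> S"
  then have "g absolutely_integrable_on cbox a b"
    using assms(2) compact_cbox[of a b] unfolding has_weak_gradient_def by blast
  then show "g \<in> borel_measurable (lebesgue_on (cbox a b))"
    using absolutely_integrable_measurable[of "cbox a b" g] lmeasurable_cbox[of a b] by blast
qed

lemma has_weak_gradient_test:
  assumes "has_weak_gradient S u g" "\<phi> \<in> test_functions S" "b \<in> Basis"
  shows "integral\<^sup>L (lebesgue_on S) (\<lambda>x. u x * frechet_derivative \<phi> (at x) b)
    = - integral\<^sup>L (lebesgue_on S) (\<lambda>x. (g x \<bullet> b) * \<phi> x)"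
  using assms unfolding has_weak_gradient_def by blast

lemma has_weak_gradient_component_integrable:
  assumes "has_weak_gradient S u g" "compact C" "C \<subseteq> S"
  shows "integrable lebesgue (\<lambda>x. indicator C x * (g x \<bullet> b))"
proof -
  have "g absolutely_integrable_on C"
    using assms by (simp add: has_weak_gradient_def)
  then have "integrable lebesgue (\<lambda>x. (indicator C x *\<^sub>R g x) \<bullet> b)"
    unfolding set_integrable_def by (intro integrable_inner_left)
  then show ?thesis by simp
qed

text \<open>Inserting the indicator of C produces a factor that is integrable over the whole space
  when f is a weak gradient component and C is compact.\<close>

lemma lebesgue_on_integral_test:
  fixes f :: "'a::euclidean_space \<Rightarrow> real"
  assumes "open S" "C \<subseteq> S" "\<And>x. x \<notin> C \<Longrightarrow> \<phi> x = 0"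
  shows "integral\<^sup>L (lebesgue_on S) (\<lambda>x. f x * \<phi> x) = integral\<^sup>L lebesgue (\<lambda>x. indicator C x * f x * \<phi> x)"
proof -
  have "integral\<^sup>L (lebesgue_on S) (\<lambda>x. f x * \<phi> x) = integral\<^sup>L lebesgue (\<lambda>x. indicator S x *\<^sub>R (f x * \<phi> x))"
    using assms(1) by (intro integral_restrict_space) (auto simp: borel_open)
  also have "(\<lambda>x. indicator S x *\<^sub>R (f x * \<phi> x)) = (\<lambda>x. indicator C x * f x * \<phi> x)"
    using assms(2,3) by (auto simp: fun_eq_iff indicator_def)
  finally show ?thesis .
qed

lemma integrable_mult_bounded:
  fixes f g :: "'a \<Rightarrow> real"
  assumes "integrable M f" "g \<in> borel_measurable M" "\<And>x. \<bar>g x\<bar> \<le> B"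
  shows "integrable M (\<lambda>x. f x * g x)"
proof (rule Bochner_Integration.integrable_bound)
  show "integrable M (\<lambda>x. B * f x)" using assms(1) by simp
  have "0 \<le> B"
    by (rule order_trans[OF abs_ge_zero assms(3)])
  then have "norm (f x * g x) \<le> norm (B * f x)" for x
    using assms(3)[of x] mult_left_mono[of "\<bar>g x\<bar>" B "\<bar>f x\<bar>"] by (simp add: abs_mult mult.commute)
  then show "AE x in M. norm (f x * g x) \<le> norm (B * f x)" by simp
qed (use assms in auto)

text \<open>The fundamental lemma of the calculus of variations. Both gradients have the same
  integrals against box bumps; as j grows, dominated convergence (bumps are at most 1) gives zero
  integral of each component of g - g' over boxes inside S.\<close>

lemma has_weak_gradient_unique:
  fixes g g' :: "'a::euclidean_space \<Rightarrow> 'a"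
  assumes "open S" and g: "has_weak_gradient S u g" and g': "has_weak_gradient S u g'"
  shows "AE x in lebesgue_on S. g x = g' x"
proof (rule AE_lebesgue_on_open[OF assms(1)])
  fix c d :: 'a assume cd: "cbox c d \<subseteq> S"
  have "AE x in lebesgue. indicator (box c d) x * ((g x - g' x) \<bullet> i) = 0" if i: "i \<in> Basis" for i
  proof (rule AE_eq_0_if_box_integrals_eq_0[where c=c and d=d])
    have int: "integrable lebesgue (\<lambda>x. indicator (cbox a b) x * ((g x - g' x) \<bullet> i))" if "cbox a b \<subseteq> S" for a b
      using Bochner_Integration.integrable_diff[OF
          has_weak_gradient_component_integrable[OF g compact_cbox that, of i]
          has_weak_gradient_component_integrable[OF g' compact_cbox that, of i]]
      by (simp add: algebra_simps)
    have "integrable lebesgue (\<lambda>x. indicator (box c d) x *\<^sub>R (indicator (cbox c d) x * ((g x - g' x) \<bullet> i)))"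
      by (intro integrable_mult_indicator int cd) auto
    moreover have "(\<lambda>x. indicator (box c d) x *\<^sub>R (indicator (cbox c d) x * ((g x - g' x) \<bullet> i)))
        = (\<lambda>x. indicator (box c d) x * ((g x - g' x) \<bullet> i))"
      using box_subset_cbox[of c d] by (auto simp: indicator_def fun_eq_iff)
    ultimately show "integrable lebesgue (\<lambda>x. indicator (box c d) x * ((g x - g' x) \<bullet> i))"
      by (simp only:)
    fix a' b' :: 'a
    \<comment> \<open>The criterion asks about arbitrary boxes, but a bump is a test function only
      if its closed box lies in S. Since the difference is cut off to \<open>box c d\<close>, the
      box with corners a' and b' may be intersected with it.\<close>
    define a b where "a = (\<Sum>i\<in>Basis. max (a' \<bullet> i) (c \<bullet> i) *\<^sub>R i)"
      and "b = (\<Sum>i\<in>Basis. min (b' \<bullet> i) (d \<bullet> i) *\<^sub>R i)"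
    have ab: "box a' b' \<inter> box c d = box a b" "cbox a b \<subseteq> S"
      using cd by (auto simp: a_def b_def mem_box)
    let ?\<phi> = "\<lambda>j. box_bump (real (Suc j)) a b"
    have out: "?\<phi> j x = 0" if "x \<notin> cbox a b" for j x
      using that box_subset_cbox[of a b] by (intro box_bump_eq_0) auto
    have meas: "?\<phi> j \<in> borel_measurable lebesgue" for j
      using borel_measurable_continuous_onI[OF Ck_fun_continuous[OF Ck_fun_box_bump[of 0 "real (Suc j)" a b]]]
      by (intro measurable_completion) simp
    have bdd: "\<bar>?\<phi> j x\<bar> \<le> 1" for j x
      using box_bump_nonneg box_bump_le_1 by (simp add: abs_le_iff order_trans[OF _ box_bump_nonneg])
    have zero: "integral\<^sup>L lebesgue (\<lambda>x. indicator (cbox a b) x * ((g x - g' x) \<bullet> i) * ?\<phi> j x) = 0" for j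
    proof -
      have test: "?\<phi> j \<in> test_functions S"
        by (rule box_bump_test_function[OF _ ab(2)]) simp
      have "integral\<^sup>L (lebesgue_on S) (\<lambda>x. (g x \<bullet> i) * ?\<phi> j x)
          = integral\<^sup>L (lebesgue_on S) (\<lambda>x. (g' x \<bullet> i) * ?\<phi> j x)"
        using trans[OF sym[OF has_weak_gradient_test[OF g test i]] has_weak_gradient_test[OF g' test i]]
        by (rule neg_equal_iff_equal[THEN iffD1])
      moreover have "integral\<^sup>L (lebesgue_on S) (\<lambda>x. f x * ?\<phi> j x)
          = integral\<^sup>L lebesgue (\<lambda>x. indicator (cbox a b) x * f x * ?\<phi> j x)" for f
        by (rule lebesgue_on_integral_test[OF assms(1) ab(2)]) (rule out)
      ultimately have "integral\<^sup>L lebesgue (\<lambda>x. indicator (cbox a b) x * (g x \<bullet> i) * ?\<phi> j x)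
          = integral\<^sup>L lebesgue (\<lambda>x. indicator (cbox a b) x * (g' x \<bullet> i) * ?\<phi> j x)"
        by (simp only:)
      moreover have "integrable lebesgue (\<lambda>x. indicator (cbox a b) x * (g x \<bullet> i) * ?\<phi> j x)"
        "integrable lebesgue (\<lambda>x. indicator (cbox a b) x * (g' x \<bullet> i) * ?\<phi> j x)"
        by (rule integrable_mult_bounded[OF _ meas bdd],
            rule has_weak_gradient_component_integrable[OF _ compact_cbox ab(2)], fact)+
      ultimately show ?thesis
        by (simp add: inner_diff_left left_diff_distrib right_diff_distrib)
    qed
    have "(\<lambda>j. integral\<^sup>L lebesgue (\<lambda>x. indicator (cbox a b) x * ((g x - g' x) \<bullet> i) * ?\<phi> j x))
        \<longlonglongrightarrow> integral\<^sup>L lebesgue (\<lambda>x. indicator (cbox a b) x * ((g x - g' x) \<bullet> i) * indicator (box a b) x)"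
    proof (rule integral_dominated_convergence)
      show "integrable lebesgue (\<lambda>x. \<bar>indicator (cbox a b) x * ((g x - g' x) \<bullet> i)\<bar>)"
        by (intro integrable_abs int ab(2))
      show "(\<lambda>x. indicator (cbox a b) x * ((g x - g' x) \<bullet> i) * ?\<phi> j x) \<in> borel_measurable lebesgue" for j
        by (rule borel_measurable_times[OF borel_measurable_integrable[OF int[OF ab(2)]] meas])
      show "(\<lambda>x. indicator (cbox a b) x * ((g x - g' x) \<bullet> i) * indicator (box a b) x) \<in> borel_measurable lebesgue"
        by (rule borel_measurable_times[OF borel_measurable_integrable[OF int[OF ab(2)]]])
          (auto intro: borel_measurable_indicator)
      show "AE x in lebesgue. (\<lambda>j. indicator (cbox a b) x * ((g x - g' x) \<bullet> i) * ?\<phi> j x)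
          \<longlonglongrightarrow> indicator (cbox a b) x * ((g x - g' x) \<bullet> i) * indicator (box a b) x"
        by (intro AE_I2 tendsto_mult tendsto_const box_bump_tendsto_indicator)
      show "AE x in lebesgue. norm (indicator (cbox a b) x * ((g x - g' x) \<bullet> i) * ?\<phi> j x)
          \<le> \<bar>indicator (cbox a b) x * ((g x - g' x) \<bullet> i)\<bar>" for j
        using bdd[of j] by (intro AE_I2) (simp add: abs_mult mult_left_le)
    qed
    then have "integral\<^sup>L lebesgue (\<lambda>x. indicator (cbox a b) x * ((g x - g' x) \<bullet> i) * indicator (box a b) x) = 0"
      unfolding zero by (simp add: LIMSEQ_const_iff)
    moreover have "indicator (cbox a b) x * ((g x - g' x) \<bullet> i) * indicator (box a b) x
        = indicator (box a' b') x * (indicator (box c d) x * ((g x - g' x) \<bullet> i))" for x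
    proof -
      have "indicator (cbox a b) x * indicator (box a b) x = (indicator (box a b) x :: real)"
        using box_subset_cbox[of a b] by (auto simp: indicator_def)
      also have "\<dots> = indicator (box a' b') x * indicator (box c d) x"
        by (simp add: ab(1)[symmetric] indicator_inter_arith)
      finally show ?thesis by (simp add: mult_ac)
    qed
    ultimately show "integral\<^sup>L lebesgue (\<lambda>x. indicator (box a' b') x * (indicator (box c d) x * ((g x - g' x) \<bullet> i))) = 0"
      by simp
  qed simp
  then have "AE x in lebesgue. \<forall>i\<in>Basis. indicator (box c d) x * ((g x - g' x) \<bullet> i) = 0"
    by (subst AE_ball_countable) (auto intro: countable_finite)
  then show "AE x in lebesgue. x \<in> box c d \<longrightarrow> g x = g' x"
    by eventually_elim (auto simp: euclidean_eq_iff[of "g _"] inner_diff_left)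
qed

text \<open>\<open>weak_gradient\<close> is an arbitrary choice; uniqueness transfers to it a bound
  known for one explicit weak gradient.\<close>

lemma Linf_norm_weak_gradient_le:
  fixes g :: "'a::euclidean_space \<Rightarrow> 'a"
  assumes "open S" "has_weak_gradient S u g" "\<And>x. x \<in> S \<Longrightarrow> norm (g x) \<le> c"
  shows "Linf_norm S (weak_gradient S u) \<le> ereal c"
proof -
  have w: "has_weak_gradient S u (weak_gradient S u)"
    unfolding weak_gradient_def by (rule someI[of "has_weak_gradient S u", OF assms(2)])
  have "AE x in lebesgue_on S. g x = weak_gradient S u x"
    by (rule has_weak_gradient_unique[OF assms(1,2) w])
  moreover have "AE x in lebesgue_on S. norm (g x) \<le> c"
    by (rule AE_I2) (use assms(3) in auto)
  ultimately have "AE x in lebesgue_on S. ereal (norm (weak_gradient S u x)) \<le> ereal c"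
    by eventually_elim simp
  moreover have [measurable]: "weak_gradient S u \<in> borel_measurable (lebesgue_on S)"
    by (rule has_weak_gradient_measurable[OF assms(1) w])
  ultimately show ?thesis
    unfolding Linf_norm_def by (intro esssup_I) auto
qed

section \<open>Mollified Lipschitz functions\<close>

definition mollify_grad :: "('a::euclidean_space \<Rightarrow> real) \<Rightarrow> ('a \<Rightarrow> real) \<Rightarrow> 'a \<Rightarrow> 'a" where
  "mollify_grad K W x = (\<Sum>i\<in>Basis. mollify_deriv K W x i *\<^sub>R i)"

text \<open>The complement of the closed support is open, so the derivative vanishes there together
  with the function.\<close>

lemma test_function_support:
  assumes "\<phi> \<in> test_functions S"
  shows "\<exists>C. compact C \<and> C \<subseteq> S \<and>
    (\<forall>x. x \<notin> C \<longrightarrow> \<phi> x = 0 \<and> frechet_derivative \<phi> (at x) = (\<lambda>_. 0))"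
proof (intro exI[of _ "closure {x. \<phi> x \<noteq> 0}"] conjI allI impI)
  have out: "\<phi> x = 0" if "x \<notin> closure {x. \<phi> x \<noteq> 0}" for x
    using that closure_subset[of "{x. \<phi> x \<noteq> 0}"] by auto
  show "\<phi> x = 0" if "x \<notin> closure {x. \<phi> x \<noteq> 0}" for x
    using that by (rule out)
  show "frechet_derivative \<phi> (at x) = (\<lambda>_. 0)" if "x \<notin> closure {x. \<phi> x \<noteq> 0}" for x
  proof (rule frechet_derivative_eq_0_outside)
    show "open (- closure {x. \<phi> x \<noteq> 0})" by (rule open_Compl[OF closed_closure])
    show "x \<in> - closure {x. \<phi> x \<noteq> 0}" using that by simp
    show "\<phi> y = 0" if "y \<in> - closure {x. \<phi> x \<noteq> 0}" for y
      using that by (intro out) (rule ComplD)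
  qed
qed (use assms in \<open>auto simp: test_functions_def\<close>)

lemma test_function_Ck: "\<phi> \<in> test_functions S \<Longrightarrow> Ck_fun k \<phi>"
  by (simp add: test_functions_def)

lemma continuous_absolutely_integrable_on_compact:
  fixes f :: "'a::euclidean_space \<Rightarrow> 'b::euclidean_space"
  assumes "continuous_on C f" "compact C"
  shows "f absolutely_integrable_on C"
proof -
  have int: "integrable lborel (\<lambda>x. indicator C x *\<^sub>R f x)"
    by (rule borel_integrable_compact[OF assms(2,1)])
  then have "integrable lebesgue (\<lambda>x. indicator C x *\<^sub>R f x)"
    using integrable_completion[OF borel_measurable_integrable[OF int]] by simp
  then show ?thesis by (simp add: set_integrable_def)
qed

context
  fixes K W :: "'a::euclidean_space \<Rightarrow> real" and d :: real and a b :: 'a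
  assumes K: "smoothing_kernel d K"
    and W: "continuous_on UNIV W" "\<forall>x. x \<notin> cbox a b \<longrightarrow> W x = 0"
begin

lemma mollify_grad_inner: "mollify_grad K W x \<bullet> h = mollify_deriv K W x h"
proof -
  have "mollify_grad K W x \<bullet> h = (\<Sum>i\<in>Basis. (h \<bullet> i) * mollify_deriv K W x i)"
    unfolding mollify_grad_def inner_sum_left inner_scaleR_left
    by (intro sum.cong refl) (simp add: inner_commute)
  also have "\<dots> = mollify_deriv K W x h"
    by (rule mollify_deriv_sum_Basis[OF K W, symmetric])
  finally show ?thesis .
qed

lemma continuous_mollify_grad: "continuous_on UNIV (mollify_grad K W)"
  unfolding mollify_grad_def
  by (intro continuous_on_sum continuous_on_scaleR continuous_on_const continuous_mollify_deriv[OF K W])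

text \<open>The product of the mollified function with a test function has compact support, so its
  directional derivative integrates to 0; the product rule splits this into the two sides of the
  weak identity.\<close>

lemma mollify_has_weak_gradient:
  assumes "open S"
  shows "has_weak_gradient S (mollify K W) (mollify_grad K W)"
  unfolding has_weak_gradient_def
proof (intro conjI allI ballI impI)
  fix C :: "'a set" assume "compact C \<and> C \<subseteq> S"
  then have "compact C" ..
  then show "mollify K W absolutely_integrable_on C" "mollify_grad K W absolutely_integrable_on C"
    by (rule continuous_absolutely_integrable_on_compact[OF
          continuous_on_subset[OF continuous_mollify[OF K W] subset_UNIV]],
        rule continuous_absolutely_integrable_on_compact[OF
          continuous_on_subset[OF continuous_mollify_grad subset_UNIV]])
next
  note cont = continuous_mollify[OF K W] and contd = continuous_mollify_deriv[OF K W]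
  fix \<phi> and i :: 'a assume \<phi>: "\<phi> \<in> test_functions S" and i: "i \<in> Basis"
  obtain C where C: "compact C" "C \<subseteq> S"
    "\<forall>x. x \<notin> C \<longrightarrow> \<phi> x = 0 \<and> frechet_derivative \<phi> (at x) = (\<lambda>_. 0)"
    using test_function_support[OF \<phi>] by (elim exE conjE)
  obtain R where R: "\<forall>x\<in>C. norm x \<le> R"
    using compact_imp_bounded[OF C(1)] unfolding bounded_iff ..
  obtain c where c: "C \<subseteq> cbox (- c) (c::'a)"
    using bounded_subset_cbox_symmetric[OF compact_imp_bounded[OF C(1)]] by metis
  have cont\<phi>: "continuous_on UNIV \<phi>"
    by (rule Ck_fun_continuous[OF test_function_Ck[OF \<phi>, of 0]])
  have contD: "continuous_on UNIV (\<lambda>x. frechet_derivative \<phi> (at x) i)"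
    by (rule continuous_frechet_derivative[OF test_function_Ck[OF \<phi>]])
  let ?A = "\<lambda>x. mollify K W x * frechet_derivative \<phi> (at x) i"
  let ?B = "\<lambda>x. mollify_deriv K W x i * \<phi> x"
  have cA: "continuous_on UNIV ?A" by (rule continuous_on_mult[OF cont contD])
  have cB: "continuous_on UNIV ?B" by (rule continuous_on_mult[OF contd cont\<phi>])
  have oA: "?A x = 0" and oB: "?B x = 0" if "x \<notin> C" for x
    using C(3) that by simp_all
  have "integral\<^sup>L lborel (\<lambda>x. ?A x + ?B x) = 0"
  proof (rule integral_directional_derivative_eq_0[where F="\<lambda>x. mollify K W x * \<phi> x" and h=i and R=R])
    fix x
    have "((\<lambda>t. mollify K W (x + t *\<^sub>R i) * \<phi> (x + t *\<^sub>R i)) has_real_derivative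
      mollify_deriv K W x i * \<phi> (x + 0 *\<^sub>R i) + frechet_derivative \<phi> (at x) i * mollify K W (x + 0 *\<^sub>R i)) (at 0)"
      by (rule DERIV_mult[OF mollify_directional_derivative[OF K W]
            Ck_fun_directional_derivative[OF test_function_Ck[OF \<phi>]]])
    then show "((\<lambda>t. mollify K W (x + t *\<^sub>R i) * \<phi> (x + t *\<^sub>R i)) has_real_derivative
      ?A x + ?B x) (at 0)"
      by (simp add: add.commute mult.commute)
  next
    show "continuous_on UNIV (\<lambda>x. mollify K W x * \<phi> x)"
      by (rule continuous_on_mult[OF cont cont\<phi>])
    show "continuous_on UNIV (\<lambda>x. ?A x + ?B x)"
      by (rule continuous_on_add[OF cA cB])
    fix x :: 'a assume "norm x > R"
    then have "x \<notin> C" using R by (meson not_le)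
    then show "mollify K W x * \<phi> x = 0" "?A x + ?B x = 0"
      using C(3) oA oB by simp_all
  qed
  moreover have "integrable lborel ?A"
    by (rule integrable_lborel_compact_support[OF cA oA]) (use c in blast)
  moreover have "integrable lborel ?B"
    by (rule integrable_lborel_compact_support[OF cB oB]) (use c in blast)
  ultimately have "integral\<^sup>L lborel ?A = - integral\<^sup>L lborel ?B"
    by (simp add: eq_neg_iff_add_eq_0)
  moreover have "integral\<^sup>L (lebesgue_on S) ?A = integral\<^sup>L lborel ?A"
    by (rule integral_lebesgue_on_eq_lborel[OF assms borel_measurable_continuous_onI[OF cA] oA])
      (use C(2) in blast)
  moreover have "integral\<^sup>L (lebesgue_on S) ?B = integral\<^sup>L lborel ?B"
    by (rule integral_lebesgue_on_eq_lborel[OF assms borel_measurable_continuous_onI[OF cB] oB])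
      (use C(2) in blast)
  ultimately show "integral\<^sup>L (lebesgue_on S) ?A
      = - integral\<^sup>L (lebesgue_on S) (\<lambda>x. (mollify_grad K W x \<bullet> i) * \<phi> x)"
    unfolding mollify_grad_inner by (simp only:)
qed

text \<open>The mollified function inherits the Lipschitz constant, so every directional derivative
  along h is at most L |h|. Taking h to be the gradient itself gives |g|^2 <= L |g|.\<close>

lemma mollify_grad_le:
  assumes L: "\<And>x y. \<bar>W x - W y\<bar> \<le> L * norm (x - y)"
  shows "norm (mollify_grad K W x) \<le> L"
proof -
  let ?g = "mollify_grad K W x"
  have "\<bar>mollify_deriv K W x h\<bar> \<le> L * norm h" for h
  proof -
    have "((\<lambda>t. mollify K W (x + t *\<^sub>R h)) has_real_derivative mollify_deriv K W x h) (at 0)"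
      by (rule mollify_directional_derivative[OF K W])
    then have "((\<lambda>t. (mollify K W (x + t *\<^sub>R h) - mollify K W x) / t) \<longlongrightarrow> mollify_deriv K W x h) (at 0)"
      by (simp add: DERIV_def)
    then have lim: "((\<lambda>t. \<bar>(mollify K W (x + t *\<^sub>R h) - mollify K W x) / t\<bar>) \<longlongrightarrow> \<bar>mollify_deriv K W x h\<bar>) (at 0)"
      by (rule tendsto_rabs)
    show ?thesis
    proof (rule tendsto_upperbound[OF lim])
      have "\<bar>(mollify K W (x + t *\<^sub>R h) - mollify K W x) / t\<bar> \<le> L * norm h" if "t \<noteq> 0" for t
      proof -
        have "\<bar>mollify K W (x + t *\<^sub>R h) - mollify K W x\<bar> \<le> L * norm (t *\<^sub>R h)"
        proof (rule mollify_diff_le[OF K W(1) W(1)])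
          show "\<bar>W (x + t *\<^sub>R h + z) - W (x + z)\<bar> \<le> L * norm (t *\<^sub>R h)" for z
            using L[of "x + t *\<^sub>R h + z" "x + z"] by (simp add: algebra_simps)
        qed
        then show ?thesis using that by (simp add: abs_divide pos_divide_le_eq mult_ac)
      qed
      then show "\<forall>\<^sub>F t in at 0. \<bar>(mollify K W (x + t *\<^sub>R h) - mollify K W x) / t\<bar> \<le> L * norm h"
        by (simp add: eventually_at_filter)
    qed simp
  qed
  from this[of ?g] have "norm ?g * norm ?g \<le> L * norm ?g"
    unfolding mollify_grad_inner[symmetric] by (simp add: dot_square_norm power2_eq_square)
  moreover have "0 \<le> L"
  proof -
    obtain i :: 'a where "i \<in> Basis" using nonempty_Basis by blast
    then show ?thesis using L[of i 0] by simp
  qed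
  ultimately show ?thesis
    by (cases "norm ?g = 0") (simp_all add: mult_le_cancel_right)
qed

text \<open>The support condition matches the smoothing radius: if x is on the frontier, W vanishes
  at all points within distance d of x, since otherwise x would lie in a ball contained in S. The
  average at x is then 0, which is the boundary condition.\<close>

lemma mollify_J_le:
  assumes "open S" "bounded S" and supp: "\<And>x. W x \<noteq> 0 \<Longrightarrow> cball x d \<subseteq> S"
    and L: "\<And>x y. \<bar>W x - W y\<bar> \<le> L * norm (x - y)"
  shows "mollify K W \<in> W1inf0 S" "J_fun S (mollify K W) \<le> ereal L"
proof -
  note cont = continuous_mollify[OF K W]
  have "mollify K W \<in> borel_measurable lborel"
    using borel_measurable_continuous_onI[OF cont] by simp
  then have meas: "mollify K W \<in> borel_measurable (lebesgue_on S)"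
    by (intro measurable_restrict_space1 measurable_completion)
  have "mollify_grad K W \<in> borel_measurable lborel"
    using borel_measurable_continuous_onI[OF continuous_mollify_grad] by simp
  then have measg: "mollify_grad K W \<in> borel_measurable (lebesgue_on S)"
    by (intro measurable_restrict_space1 measurable_completion)
  note weak = mollify_has_weak_gradient[OF assms(1)]
  have "compact (mollify K W ` closure S)"
    using assms(2) by (intro compact_continuous_image continuous_on_subset[OF cont]) auto
  then have "bounded (mollify K W ` closure S)" by (rule compact_imp_bounded)
  then obtain B where "\<forall>y\<in>mollify K W ` closure S. norm y \<le> B"
    unfolding bounded_iff ..
  then have B: "\<bar>mollify K W x\<bar> \<le> B" if "x \<in> S" for x
    using subsetD[OF closure_subset that] by simp
  have "Linf_norm S (mollify K W) \<le> ereal B"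
    unfolding Linf_norm_def using meas B by (intro esssup_I) auto
  then have "Linf_norm S (mollify K W) < \<infinity>"
    by (rule order_le_less_trans) simp
  moreover have "Linf_norm S (mollify_grad K W) \<le> ereal L"
    unfolding Linf_norm_def using measg mollify_grad_le[OF L] by (intro esssup_I) auto
  then have "Linf_norm S (mollify_grad K W) < \<infinity>"
    by (rule order_le_less_trans) simp
  ultimately have "mollify K W \<in> W1inf S"
    unfolding W1inf_def using meas weak measg by auto
  moreover have "mollify K W x = 0" if "x \<in> frontier S" for x
  proof -
    have "x \<notin> S" using that assms(1) by (simp add: frontier_def interior_open)
    have "W (x + z) = 0" if z: "norm z \<le> d" for z
    proof (rule ccontr)
      assume "W (x + z) \<noteq> 0"
      then have "cball (x + z) d \<subseteq> S" by (rule supp)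
      moreover have "x \<in> cball (x + z) d" using z by (simp add: dist_norm)
      ultimately show False using \<open>x \<notin> S\<close> by blast
    qed
    then have "\<bar>mollify K W x - 0\<bar> \<le> 0"
      by (intro mollify_approx[OF K W(1)]) simp
    then show ?thesis by simp
  qed
  ultimately show *: "mollify K W \<in> W1inf0 S"
    unfolding W1inf0_def using continuous_on_subset[OF cont subset_UNIV] by auto
  have "Linf_norm S (weak_gradient S (mollify K W)) \<le> ereal L"
    by (rule Linf_norm_weak_gradient_le[OF assms(1) weak mollify_grad_le[OF L]])
  then show "J_fun S (mollify K W) \<le> ereal L"
    using * by (simp add: J_fun_def)
qed

end

section \<open>Pointwise bounds by the distance to the boundary\<close>

lemma frechet_derivative_translate:
  fixes f :: "'a::euclidean_space \<Rightarrow> real"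
  assumes "Ck_fun (Suc k) f"
  shows "((\<lambda>y. f (y - q)) has_derivative frechet_derivative f (at (x - q))) (at x)"
    and "frechet_derivative (\<lambda>y. f (y - q)) (at x) = frechet_derivative f (at (x - q))"
proof -
  have "((\<lambda>y. y - q) has_derivative (\<lambda>h. h)) (at x)"
    by (auto intro!: derivative_eq_intros)
  then show *: "((\<lambda>y. f (y - q)) has_derivative frechet_derivative f (at (x - q))) (at x)"
    using Ck_fun_Suc_has_derivative[OF assms] by (rule has_derivative_compose)
  show "frechet_derivative (\<lambda>y. f (y - q)) (at x) = frechet_derivative f (at (x - q))"
    by (rule frechet_derivative_eqI[OF *])
qed

lemma Ck_fun_translate:
  assumes "Ck_fun k f"
  shows "Ck_fun k (\<lambda>y. f (y - q))"
  using assms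
proof (induction k arbitrary: f)
  case 0
  then show ?case by (auto intro!: continuous_on_compose2[of UNIV f] continuous_intros)
next
  case (Suc k)
  have "(\<lambda>y. f (y - q)) differentiable (at x)" for x
    using frechet_derivative_translate(1)[OF Suc.prems] by (rule differentiableI)
  then have "(\<lambda>y. f (y - q)) differentiable_on UNIV"
    by (simp add: differentiable_on_def)
  moreover have "Ck_fun k (\<lambda>x. frechet_derivative (\<lambda>y. f (y - q)) (at x) b)" if "b \<in> Basis" for b
    unfolding frechet_derivative_translate(2)[OF Suc.prems]
    by (rule Suc.IH) (use Suc.prems that in simp)
  ultimately show ?case by simp
qed

lemma integrable_lebesgue_on_open:
  fixes f :: "'a::euclidean_space \<Rightarrow> real"
  assumes "open S" "integrable lebesgue f"
  shows "integrable (lebesgue_on S) f"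
proof -
  have "S \<in> sets lebesgue" using assms(1) by (simp add: borel_open)
  then show ?thesis
    using integrable_mult_indicator[OF _ assms(2)] by (simp add: integrable_restrict_space)
qed

text \<open>Here \<open>v\<close> is the given function and \<open>w\<close> its continuous representative, extended by zero.\<close>

context
  fixes S :: "'a::euclidean_space set" and v w :: "'a \<Rightarrow> real" and g :: "'a \<Rightarrow> 'a" and M :: real
  assumes S: "open S"
    and w: "continuous_on UNIV w" "\<And>x. x \<notin> S \<Longrightarrow> w x = 0"
    and v: "v \<in> borel_measurable (lebesgue_on S)" "AE x in lebesgue_on S. v x = w x"
    and g: "has_weak_gradient S v g" "AE x in lebesgue_on S. norm (g x) \<le> M"
begin

text \<open>The kernel centred at q is supported in S, hence a test function, and the weak identity
  moves the derivative onto g; its sign cancels the one in \<open>mollify_deriv\<close>. Extending w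
  by zero lets the integral over S be read over the whole space.\<close>

lemma mollify_deriv_eq_weak_gradient:
  assumes K: "smoothing_kernel d K" and q: "cball q d \<subseteq> S" and i: "i \<in> Basis"
  shows "mollify_deriv K w q i = integral\<^sup>L (lebesgue_on S) (\<lambda>y. (g y \<bullet> i) * K (y - q))"
proof -
  have "(\<lambda>y. K (y - q)) \<in> test_functions S"
  proof (rule mem_test_functionsI)
    show "Ck_fun k (\<lambda>y. K (y - q))" for k
      by (rule Ck_fun_translate[OF kernel_Ck[OF K]])
    show "y \<in> cball q d" if "K (y - q) \<noteq> 0" for y
    proof (rule ccontr)
      assume "y \<notin> cball q d"
      then have "norm (y - q) > d" by (simp add: dist_norm norm_minus_commute)
      then show False using that kernel_eq_0[OF K] by simp
    qed
  qed (use q in simp_all)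
  from has_weak_gradient_test[OF g(1) this i]
  have eq: "integral\<^sup>L (lebesgue_on S) (\<lambda>y. v y * frechet_derivative K (at (y - q)) i)
      = - integral\<^sup>L (lebesgue_on S) (\<lambda>y. (g y \<bullet> i) * K (y - q))"
    unfolding frechet_derivative_translate(2)[OF kernel_Ck[OF K]] .
  have contD: "continuous_on UNIV (\<lambda>y. frechet_derivative K (at (y - q)) i)"
    by (rule continuous_on_compose2[OF kernel_deriv_cont[OF K]]) (auto intro!: continuous_intros)
  have cont: "continuous_on UNIV (\<lambda>y. w y * frechet_derivative K (at (y - q)) i)"
    by (rule continuous_on_mult[OF w(1) contD])
  have mS: "f \<in> borel_measurable (lebesgue_on S)" if "continuous_on UNIV f" for f :: "'a \<Rightarrow> real"
    using borel_measurable_continuous_onI[OF that]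
    by (intro measurable_restrict_space1 measurable_completion) simp
  have "integral\<^sup>L (lebesgue_on S) (\<lambda>y. v y * frechet_derivative K (at (y - q)) i)
      = integral\<^sup>L (lebesgue_on S) (\<lambda>y. w y * frechet_derivative K (at (y - q)) i)"
  proof (rule integral_cong_AE)
    show "(\<lambda>y. v y * frechet_derivative K (at (y - q)) i) \<in> borel_measurable (lebesgue_on S)"
      by (rule borel_measurable_times[OF v(1) mS[OF contD]])
    show "AE y in lebesgue_on S. v y * frechet_derivative K (at (y - q)) i
        = w y * frechet_derivative K (at (y - q)) i"
      using v(2) by eventually_elim simp
  qed (rule mS[OF cont])
  also have "\<dots> = integral\<^sup>L lborel (\<lambda>y. w y * frechet_derivative K (at (y - q)) i)"
    by (rule integral_lebesgue_on_eq_lborel[OF S borel_measurable_continuous_onI[OF cont]])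
      (simp add: w(2))
  finally show ?thesis
    using eq by (simp add: mollify_deriv_def)
qed

text \<open>The derivative is an average of \<open>g y \<bullet> h\<close> with total weight one, so
  Cauchy-Schwarz bounds it by M |h|. Unlike \<open>mollify_grad_le\<close>, this starts from a bound
  on the weak gradient and is local: the kernel ball must lie in S.\<close>

lemma mollify_deriv_bound:
  assumes K: "smoothing_kernel d K" and q: "cball q d \<subseteq> S"
    and supp: "\<forall>x. x \<notin> cbox a b \<longrightarrow> w x = 0"
  shows "\<bar>mollify_deriv K w q h\<bar> \<le> M * norm h"
proof -
  have out: "K (y - q) = 0" if "y \<notin> cball q d" for y
    using that by (intro kernel_eq_0[OF K]) (simp add: dist_norm norm_minus_commute)
  have Kq: "continuous_on UNIV (\<lambda>y. K (y - q))"
    by (rule continuous_on_compose2[OF kernel_cont[OF K]]) (auto intro!: continuous_intros)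
  obtain c where c: "cball q d \<subseteq> cbox (- c) (c::'a)"
    using bounded_subset_cbox_symmetric[OF bounded_cball] by metis
  have intK: "integrable lborel (\<lambda>y. K (y - q))"
    by (rule integrable_lborel_compact_support[OF Kq out]) (use c in blast)
  have measK: "(\<lambda>y. K (y - q)) \<in> borel_measurable lborel"
    using intK by (rule borel_measurable_integrable)
  have "integrable lebesgue (\<lambda>y. K (y - q))"
    using integrable_completion[OF measK] intK by simp
  then have intKS: "integrable (lebesgue_on S) (\<lambda>y. K (y - q))"
    by (rule integrable_lebesgue_on_open[OF S])
  have "integral\<^sup>L lborel (\<lambda>y. K (y - q)) = 1"
    using integral_lborel_shift[OF borel_measurable_continuous_onI[OF kernel_cont[OF K]], of "- q"]
    by (simp add: kernel_integral[OF K])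
  moreover have "integral\<^sup>L (lebesgue_on S) (\<lambda>y. K (y - q)) = integral\<^sup>L lborel (\<lambda>y. K (y - q))"
    by (rule integral_lebesgue_on_eq_lborel[OF S borel_measurable_continuous_onI[OF Kq] out])
      (use q in blast)
  ultimately have one: "integral\<^sup>L (lebesgue_on S) (\<lambda>y. K (y - q)) = 1" by simp
  have "bounded (range (\<lambda>y. K (y - q)))"
  proof -
    have "compact ((\<lambda>y. K (y - q)) ` cball q d)"
      by (intro compact_continuous_image continuous_on_subset[OF Kq]) auto
    then have "bounded (insert 0 ((\<lambda>y. K (y - q)) ` cball q d))"
      by (simp add: compact_imp_bounded)
    then show ?thesis
      by (rule bounded_subset) (use out in blast)
  qed
  then obtain B where "\<forall>r\<in>range (\<lambda>y. K (y - q)). norm r \<le> B"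
    unfolding bounded_iff ..
  then have B: "\<bar>K (y - q)\<bar> \<le> B" for y by simp
  have int: "integrable (lebesgue_on S) (\<lambda>y. (g y \<bullet> i) * K (y - q))" for i
  proof -
    have "integrable lebesgue (\<lambda>y. indicator (cball q d) y * (g y \<bullet> i) * K (y - q))"
      by (rule integrable_mult_bounded[OF has_weak_gradient_component_integrable[OF g(1) compact_cball q]
            measurable_completion[OF measK] B])
    moreover have "(\<lambda>y. indicator (cball q d) y * (g y \<bullet> i) * K (y - q)) = (\<lambda>y. (g y \<bullet> i) * K (y - q))"
      using out by (auto simp: fun_eq_iff indicator_def)
    ultimately have "integrable lebesgue (\<lambda>y. (g y \<bullet> i) * K (y - q))" by (simp only:)
    then show ?thesis by (rule integrable_lebesgue_on_open[OF S])
  qed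
  have "mollify_deriv K w q h = (\<Sum>i\<in>Basis. (h \<bullet> i) * mollify_deriv K w q i)"
    by (rule mollify_deriv_sum_Basis[OF K w(1) supp])
  also have "\<dots> = (\<Sum>i\<in>Basis. integral\<^sup>L (lebesgue_on S) (\<lambda>y. (h \<bullet> i) * ((g y \<bullet> i) * K (y - q))))"
    by (intro sum.cong refl) (simp add: mollify_deriv_eq_weak_gradient[OF K q])
  also have "\<dots> = integral\<^sup>L (lebesgue_on S) (\<lambda>y. \<Sum>i\<in>Basis. (h \<bullet> i) * ((g y \<bullet> i) * K (y - q)))"
    by (rule Bochner_Integration.integral_sum[symmetric]) (intro integrable_mult_right int)
  also have "(\<lambda>y. \<Sum>i\<in>Basis. (h \<bullet> i) * ((g y \<bullet> i) * K (y - q))) = (\<lambda>y. (g y \<bullet> h) * K (y - q))"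
  proof
    fix y
    have "(\<Sum>i\<in>Basis. (h \<bullet> i) * ((g y \<bullet> i) * K (y - q))) = (\<Sum>i\<in>Basis. (g y \<bullet> i) * (h \<bullet> i)) * K (y - q)"
      unfolding sum_distrib_right by (intro sum.cong refl) (simp add: mult_ac)
    then show "(\<Sum>i\<in>Basis. (h \<bullet> i) * ((g y \<bullet> i) * K (y - q))) = (g y \<bullet> h) * K (y - q)"
      by (simp only: euclidean_inner[of "g y" h])
  qed
  finally have "\<bar>mollify_deriv K w q h\<bar> = \<bar>integral\<^sup>L (lebesgue_on S) (\<lambda>y. (g y \<bullet> h) * K (y - q))\<bar>"
    by (simp only:)
  also have "\<dots> \<le> integral\<^sup>L (lebesgue_on S) (\<lambda>y. \<bar>(g y \<bullet> h) * K (y - q)\<bar>)"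
    by (rule integral_abs_bound)
  also have "\<dots> \<le> integral\<^sup>L (lebesgue_on S) (\<lambda>y. (M * norm h) * K (y - q))"
  proof (rule integral_mono_AE)
    show "integrable (lebesgue_on S) (\<lambda>y. \<bar>(g y \<bullet> h) * K (y - q)\<bar>)"
      by (rule integrable_abs[OF int])
    show "integrable (lebesgue_on S) (\<lambda>y. (M * norm h) * K (y - q))"
      by (rule integrable_mult_right[OF intKS])
    show "AE y in lebesgue_on S. \<bar>(g y \<bullet> h) * K (y - q)\<bar> \<le> (M * norm h) * K (y - q)"
      using g(2)
    proof eventually_elim
      case (elim y)
      have "\<bar>g y \<bullet> h\<bar> \<le> norm (g y) * norm h" by (rule Cauchy_Schwarz_ineq2)
      also have "\<dots> \<le> M * norm h" by (rule mult_right_mono[OF elim norm_ge_zero])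
      finally show ?case
        by (simp add: abs_mult kernel_nonneg[OF K] mult_right_mono)
    qed
  qed
  also have "\<dots> = M * norm h" by (simp add: one)
  finally show ?thesis .
qed

text \<open>The mean value inequality along the segment; \<open>seg\<close> keeps the derivative
  bound valid at each of its points.\<close>

lemma mollify_segment_bound:
  assumes K: "smoothing_kernel d K"
    and seg: "\<And>t. 0 \<le> t \<Longrightarrow> t \<le> 1 \<Longrightarrow> cball (x + t *\<^sub>R h) d \<subseteq> S"
    and supp: "\<forall>x. x \<notin> cbox a b \<longrightarrow> w x = 0"
  shows "\<bar>mollify K w (x + h) - mollify K w x\<bar> \<le> M * norm h"
proof -
  let ?m = "\<lambda>t. mollify K w (x + t *\<^sub>R h)"
  have deriv: "(?m has_real_derivative mollify_deriv K w (x + t *\<^sub>R h) h) (at t within {0..1})" for t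
  proof -
    have "((\<lambda>s. mollify K w (x + t *\<^sub>R h + s *\<^sub>R h)) has_real_derivative
        mollify_deriv K w (x + t *\<^sub>R h) h) (at 0)"
      by (rule mollify_directional_derivative[OF K w(1) supp])
    then have "(?m has_real_derivative mollify_deriv K w (x + t *\<^sub>R h) h) (at t)"
      using DERIV_shift[of ?m _ 0 t] by (simp add: algebra_simps)
    then show ?thesis by (rule has_field_derivative_at_within)
  qed
  have "norm (?m 1 - ?m 0) \<le> (M * norm h) * norm (1 - 0 :: real)"
  proof (rule field_differentiable_bound[OF _ deriv])
    fix t :: real assume "t \<in> {0..1}"
    then have "cball (x + t *\<^sub>R h) d \<subseteq> S" by (intro seg) simp_all
    then show "norm (mollify_deriv K w (x + t *\<^sub>R h) h) \<le> M * norm h"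
      unfolding real_norm_def by (rule mollify_deriv_bound[OF K _ supp])
  qed simp_all
  then show ?thesis by simp
qed

lemma representative_segment_bound:
  assumes "d > 0"
    and seg: "\<And>t. 0 \<le> t \<Longrightarrow> t \<le> 1 \<Longrightarrow> cball (x + t *\<^sub>R h) d \<subseteq> S"
    and supp: "\<forall>x. x \<notin> cbox a b \<longrightarrow> w x = 0"
  shows "\<bar>w (x + h) - w x\<bar> \<le> M * norm h"
proof (rule field_le_epsilon)
  fix e :: real assume "e > 0"
  have cw: "\<exists>d>0. \<forall>z. dist z y < d \<longrightarrow> dist (w z) (w y) < e / 2" for y
    using w(1) half_gt_zero[OF \<open>e > 0\<close>] unfolding continuous_on_iff by blast
  obtain d1 where d1: "d1 > 0" "\<forall>y. dist y x < d1 \<longrightarrow> dist (w y) (w x) < e / 2"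
    using cw[of x] by blast
  obtain d2 where d2: "d2 > 0" "\<forall>y. dist y (x + h) < d2 \<longrightarrow> dist (w y) (w (x + h)) < e / 2"
    using cw[of "x + h"] by blast
  \<comment> \<open>r <= d keeps the tube around the segment inside S; r < d1 and r < d2 make the
    smoothing error at each endpoint at most e / 2.\<close>
  define r where "r = min d (min (d1 / 2) (d2 / 2))"
  have r: "r > 0" "r \<le> d" "r < d1" "r < d2"
    using assms(1) d1(1) d2(1) by (auto simp: r_def)
  obtain K :: "'a \<Rightarrow> real" where K: "smoothing_kernel r K"
    using smoothing_kernel_exists[OF r(1)] ..
  have "\<bar>mollify K w (x + h) - mollify K w x\<bar> \<le> M * norm h"
  proof (rule mollify_segment_bound[OF K _ supp])
    fix t :: real assume "0 \<le> t" "t \<le> 1"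
    then show "cball (x + t *\<^sub>R h) r \<subseteq> S"
      using seg[of t] subset_cball[OF r(2)] by (meson order_trans)
  qed
  moreover have "\<bar>mollify K w x - w x\<bar> \<le> e / 2"
  proof (rule mollify_approx[OF K w(1)])
    fix z :: 'a assume "norm z \<le> r"
    then have "dist (x + z) x < d1" using r by (simp add: dist_norm)
    then show "\<bar>w (x + z) - w x\<bar> \<le> e / 2" using d1(2) by (simp add: dist_real_def less_imp_le)
  qed
  moreover have "\<bar>mollify K w (x + h) - w (x + h)\<bar> \<le> e / 2"
  proof (rule mollify_approx[OF K w(1)])
    fix z :: 'a assume "norm z \<le> r"
    then have "dist (x + h + z) (x + h) < d2" using r by (simp add: dist_norm)
    then show "\<bar>w (x + h + z) - w (x + h)\<bar> \<le> e / 2" using d2(2) by (simp add: dist_real_def less_imp_le)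
  qed
  ultimately show "\<bar>w (x + h) - w x\<bar> \<le> M * norm h + e" by linarith
qed

text \<open>The segment from x to a nearest outside point y leaves S only at y, where no ball around
  the point fits into S. The segment bound is therefore applied up to parameter s < 1, and s tends
  to 1 using continuity and w y = 0.\<close>

lemma representative_le_infdist:
  assumes "M \<ge> 0" "x \<in> S" "S \<noteq> UNIV"
    and supp: "\<forall>x. x \<notin> cbox a b \<longrightarrow> w x = 0"
  shows "\<bar>w x\<bar> \<le> M * infdist x (- S)"
proof -
  have "closed (- S)" using S by (rule closed_Compl)
  moreover have "- S \<noteq> {}" using assms(3) by blast
  ultimately obtain y where y: "y \<in> - S" "infdist x (- S) = dist x y"
    using infdist_attains_inf[of "- S" x] by blast
  let ?d = "dist x y"
  have ball: "ball x ?d \<subseteq> S"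
  proof
    fix z assume "z \<in> ball x ?d"
    then have "dist x z < infdist x (- S)" by (simp add: y(2))
    then show "z \<in> S" using infdist_le[of z "- S" x] by (meson ComplI not_le)
  qed
  have "?d > 0" using y(1) assms(2) by auto
  have bound: "\<bar>w x\<bar> \<le> \<bar>w (x + s *\<^sub>R (y - x))\<bar> + M * ?d" if s: "0 \<le> s" "s < 1" for s
  proof -
    have "\<bar>w (x + s *\<^sub>R (y - x)) - w x\<bar> \<le> M * norm (s *\<^sub>R (y - x))"
    proof (rule representative_segment_bound[OF _ _ supp])
      \<comment> \<open>Points of the shortened segment have distance at most s times
        \<open>?d\<close> from x. The remaining gap is (1 - s) times \<open>?d\<close>; half of it
        keeps the closed balls inside the open ball.\<close>
      show "0 < (1 - s) * ?d / 2" using s \<open>?d > 0\<close> by simp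
      fix t :: real assume t: "0 \<le> t" "t \<le> 1"
      have "cball (x + t *\<^sub>R s *\<^sub>R (y - x)) ((1 - s) * ?d / 2) \<subseteq> ball x ?d"
      proof
        fix z assume "z \<in> cball (x + t *\<^sub>R s *\<^sub>R (y - x)) ((1 - s) * ?d / 2)"
        then have "dist (x + t *\<^sub>R s *\<^sub>R (y - x)) z \<le> (1 - s) * ?d / 2" by simp
        moreover have "dist x z \<le> dist x (x + t *\<^sub>R s *\<^sub>R (y - x)) + dist (x + t *\<^sub>R s *\<^sub>R (y - x)) z"
          by (rule dist_triangle)
        moreover have "dist x (x + t *\<^sub>R s *\<^sub>R (y - x)) = t * (s * ?d)"
          using s t by (simp add: dist_norm norm_minus_commute)
        moreover have "t * (s * ?d) \<le> s * ?d"
          using s t \<open>?d > 0\<close> by (intro mult_left_le_one_le) simp_all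
        moreover have "s * ?d + (1 - s) * ?d / 2 < ?d"
        proof -
          have "(1 - s) * ?d > 0" using s \<open>?d > 0\<close> by simp
          moreover have "(1 - s) * ?d = ?d - s * ?d" by (simp add: left_diff_distrib)
          ultimately show ?thesis by linarith
        qed
        ultimately show "z \<in> ball x ?d" by simp
      qed
      then show "cball (x + t *\<^sub>R s *\<^sub>R (y - x)) ((1 - s) * ?d / 2) \<subseteq> S"
        using ball by (rule order_trans)
    qed
    also have "norm (s *\<^sub>R (y - x)) = s * ?d"
      using s by (simp add: dist_norm norm_minus_commute)
    also have "M * (s * ?d) \<le> M * ?d"
      using s assms(1) by (intro mult_left_mono mult_left_le_one_le) simp_all
    finally show ?thesis by linarith
  qed
  have "((\<lambda>s. \<bar>w (x + s *\<^sub>R (y - x))\<bar> + M * ?d) \<longlongrightarrow> \<bar>w (x + 1 *\<^sub>R (y - x))\<bar> + M * ?d) (at_left 1)"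
  proof (intro tendsto_add tendsto_rabs tendsto_const)
    have "isCont w (x + 1 *\<^sub>R (y - x))"
      using w(1) by (simp add: continuous_on_eq_continuous_at)
    then show "((\<lambda>s. w (x + s *\<^sub>R (y - x))) \<longlongrightarrow> w (x + 1 *\<^sub>R (y - x))) (at_left 1)"
      by (rule isCont_tendsto_compose) (intro tendsto_intros)
  qed
  moreover have "\<forall>\<^sub>F s in at_left (1::real). \<bar>w x\<bar> \<le> \<bar>w (x + s *\<^sub>R (y - x))\<bar> + M * ?d"
    using eventually_at_left_real[of 0 1]
    by (rule eventually_mono) (use bound in auto)
  ultimately have "\<bar>w x\<bar> \<le> \<bar>w (x + 1 *\<^sub>R (y - x))\<bar> + M * ?d"
    by (rule tendsto_lowerbound) simp
  then show ?thesis
    using w(2)[of y] y by simp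
qed

end

section \<open>Eigenfunctions and ground states\<close>

lemma measurable_lebesgue_on_continuous:
  fixes f :: "'a::euclidean_space \<Rightarrow> real"
  assumes "continuous_on UNIV f"
  shows "f \<in> borel_measurable (lebesgue_on S)"
  using borel_measurable_continuous_onI[OF assms]
  by (intro measurable_restrict_space1 measurable_completion) simp

lemma integrable_lebesgue_on_continuous:
  fixes f :: "'a::euclidean_space \<Rightarrow> real"
  assumes "open S" "bounded S" "continuous_on UNIV f"
  shows "integrable (lebesgue_on S) f"
proof -
  have "f absolutely_integrable_on closure S"
    by (rule continuous_absolutely_integrable_on_compact[OF continuous_on_subset[OF assms(3) subset_UNIV]])
      (simp add: assms(2))
  then have "f absolutely_integrable_on S"
    by (rule set_integrable_subset) (use assms(1) in \<open>simp_all add: borel_open closure_subset\<close>)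
  then show ?thesis
    using assms(1) by (simp add: set_integrable_def integrable_restrict_space borel_open)
qed

text \<open>As \<open>J_fun\<close> is extended real, the bound is given for every real M above it.
  Later it is used with M equal to the value of J, and with M = 0 to show that a nonzero v has
  positive J.\<close>

lemma W1inf0_representative:
  fixes S :: "'a::euclidean_space set"
  assumes S: "open S" "bounded S" and v: "v \<in> W1inf0 S"
  shows "\<exists>w. continuous_on UNIV w \<and> (\<forall>x. x \<notin> S \<longrightarrow> w x = 0) \<and> (AE x in lebesgue_on S. v x = w x) \<and>
    (\<forall>M\<ge>0. J_fun S v \<le> ereal M \<longrightarrow> (\<forall>x\<in>S. \<bar>w x\<bar> \<le> M * infdist x (- S)))"
proof -
  obtain w0 where w0: "continuous_on (closure S) w0" "AE x in lebesgue_on S. v x = w0 x"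
    "\<forall>x\<in>frontier S. w0 x = 0"
    using v unfolding W1inf0_def by blast
  have frontier: "x \<in> frontier S" if "x \<in> closure S" "x \<notin> S" for x
    using that S(1) by (simp add: frontier_def interior_open)
  \<comment> \<open>The two pieces meet only on the frontier, where w0 is zero, so the extension is
    continuous.\<close>
  define w where "w = (\<lambda>x. if x \<in> closure S then w0 x else 0)"
  have "continuous_on (closure S \<union> - S) w"
    unfolding w_def
  proof (rule continuous_on_cases)
    show "\<forall>x. x \<in> closure S \<and> x \<notin> closure S \<or> x \<in> - S \<and> x \<in> closure S \<longrightarrow> w0 x = 0"
      using frontier w0(3) by blast
  qed (use S(1) w0(1) in \<open>simp_all add: closed_Compl\<close>)
  moreover have "closure S \<union> - S = UNIV"
    using closure_subset[of S] by blast
  ultimately have cont: "continuous_on UNIV w" by (simp only:)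
  have zero: "w x = 0" if "x \<notin> S" for x
    using frontier[of x] w0(3) that by (simp add: w_def)
  have AE: "AE x in lebesgue_on S. v x = w x"
    using w0(2) AE_space
  proof eventually_elim
    case (elim x)
    then have "x \<in> closure S" using subsetD[OF closure_subset] by simp
    then show ?case using elim by (simp add: w_def)
  qed
  have "\<bar>w x\<bar> \<le> M * infdist x (- S)" if M: "M \<ge> 0" "J_fun S v \<le> ereal M" and x: "x \<in> S" for M x
  proof -
    have "v \<in> W1inf S" using v by (simp add: W1inf0_def)
    then have vm: "v \<in> borel_measurable (lebesgue_on S)" and ex: "\<exists>g. has_weak_gradient S v g"
      unfolding W1inf_def by blast+
    from ex have g: "has_weak_gradient S v (weak_gradient S v)"
      unfolding weak_gradient_def by (rule someI_ex[of "has_weak_gradient S v"])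
    have le: "esssup (lebesgue_on S) (\<lambda>x. ereal (norm (weak_gradient S v x))) \<le> ereal M"
      using M(2) v by (simp add: J_fun_def Linf_norm_def)
    have "AE x in lebesgue_on S. norm (weak_gradient S v x) \<le> M"
    proof (rule eventually_mono[OF esssup_AE])
      fix x assume "ereal (norm (weak_gradient S v x))
        \<le> esssup (lebesgue_on S) (\<lambda>x. ereal (norm (weak_gradient S v x)))"
      then have "ereal (norm (weak_gradient S v x)) \<le> ereal M" using le by (rule order_trans)
      then show "norm (weak_gradient S v x) \<le> M" by simp
    qed
    moreover obtain c :: 'a where "S \<subseteq> cbox (- c) c"
      using bounded_subset_cbox_symmetric[OF S(2)] by metis
    then have "\<forall>x. x \<notin> cbox (- c) c \<longrightarrow> w x = 0" using zero by blast
    moreover have "S \<noteq> UNIV" using S(2) by auto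
    ultimately show ?thesis
      using representative_le_infdist[OF S(1) cont zero vm AE g] M(1) x by blast
  qed
  then show ?thesis using cont zero AE by blast
qed

lemma eigenfunction_test_infdist:
  fixes S :: "'a::euclidean_space set" and u w :: "'a \<Rightarrow> real"
  assumes S: "open S" "bounded S" and w: "continuous_on UNIV w" "AE x in lebesgue_on S. u x = w x"
    and um: "u \<in> borel_measurable (lebesgue_on S)"
    and le: "\<And>f. f \<in> L2_space S \<Longrightarrow> ereal (L2_inner S (\<lambda>x. l * u x) f) \<le> J_fun S f" and "l > 0"
  shows "l * integral\<^sup>L (lebesgue_on S) (\<lambda>x. w x * infdist x (- S)) \<le> 1"
proof -
  let ?D = "\<lambda>x. infdist x (- S)"
  let ?\<mu> = "lebesgue_on S"
  have contD: "continuous_on UNIV ?D" by (intro continuous_intros)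
  note int = integrable_lebesgue_on_continuous[OF S]
  have contabs: "continuous_on UNIV (\<lambda>x. \<bar>w x\<bar>)" by (intro continuous_intros w(1))
  define I where "I = integral\<^sup>L ?\<mu> (\<lambda>x. \<bar>w x\<bar>)"
  have "I \<ge> 0" unfolding I_def by (rule integral_nonneg_AE) simp
  have eps: "l * integral\<^sup>L ?\<mu> (\<lambda>x. w x * ?D x) \<le> 1 + l * (2 * e * I)" if e: "e > 0" for e :: real
  proof -
    \<comment> \<open>W is nonzero only where the distance exceeds e, so closed balls of radius e /
      2 around such points stay in S.\<close>
    define W where "W = (\<lambda>x. max 0 (?D x - e))"
    have contW: "continuous_on UNIV W"
      unfolding W_def by (intro continuous_intros)
    have D1: "\<bar>?D x - ?D y\<bar> \<le> norm (x - y)" for x y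
      using infdist_triangle[of x "- S" y] infdist_triangle[of y "- S" x]
      by (simp add: dist_norm norm_minus_commute abs_le_iff)
    have W1: "\<bar>W x - W y\<bar> \<le> 1 * norm (x - y)" for x y
      using D1[of x y] unfolding W_def by linarith
    have Wout: "W x \<noteq> 0 \<Longrightarrow> cball x (e / 2) \<subseteq> S" for x
    proof
      fix z assume "W x \<noteq> 0" "z \<in> cball x (e / 2)"
      then have "e < ?D x" "dist x z \<le> e / 2" by (simp_all add: W_def max_def split: if_splits)
      then have "\<not> ?D x \<le> dist x z" using e by linarith
      then show "z \<in> S" using infdist_le[of z "- S" x] by blast
    qed
    obtain c :: 'a where c: "S \<subseteq> cbox (- c) c"
      using bounded_subset_cbox_symmetric[OF S(2)] by metis
    have supp: "\<forall>x. x \<notin> cbox (- c) c \<longrightarrow> W x = 0"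
    proof (intro allI impI)
      fix x assume "x \<notin> cbox (- c) c"
      then have "x \<in> - S" using c by blast
      then show "W x = 0" using e by (simp add: W_def)
    qed
    obtain K :: "'a \<Rightarrow> real" where K: "smoothing_kernel (e / 2) K"
      using smoothing_kernel_exists[OF half_gt_zero[OF e]] ..
    let ?f = "mollify K W"
    note contf = continuous_mollify[OF K contW supp]
    have "continuous_on UNIV (\<lambda>x. (?f x)\<^sup>2)" by (intro continuous_intros contf)
    then have f: "?f \<in> L2_space S"
      unfolding L2_space_def using measurable_lebesgue_on_continuous[OF contf] int by blast
    have "J_fun S ?f \<le> ereal 1"
      by (rule mollify_J_le(2)[OF K contW supp S Wout W1])
    then have "ereal (L2_inner S (\<lambda>x. l * u x) ?f) \<le> ereal 1"
      using le[OF f] by (rule order_trans[rotated])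
    moreover have "L2_inner S (\<lambda>x. l * u x) ?f = integral\<^sup>L ?\<mu> (\<lambda>x. l * (w x * ?f x))"
      unfolding L2_inner_def
    proof (rule integral_cong_AE)
      have m: "(\<lambda>x. l * u x) \<in> borel_measurable ?\<mu>"
        using um by simp
      show "(\<lambda>x. l * u x * ?f x) \<in> borel_measurable ?\<mu>"
        by (rule borel_measurable_times[OF m measurable_lebesgue_on_continuous[OF contf]])
      show "(\<lambda>x. l * (w x * ?f x)) \<in> borel_measurable ?\<mu>"
        by (intro measurable_lebesgue_on_continuous continuous_intros w(1) contf)
      show "AE x in ?\<mu>. l * u x * ?f x = l * (w x * ?f x)"
        using w(2) by eventually_elim simp
    qed
    ultimately have lf: "l * integral\<^sup>L ?\<mu> (\<lambda>x. w x * ?f x) \<le> 1" by simp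
    \<comment> \<open>Smoothing costs at most e / 2 and truncation at most e, which 2 e
      covers.\<close>
    have close: "\<bar>?f x - ?D x\<bar> \<le> 2 * e" for x
    proof (rule mollify_approx[OF K contW])
      fix z :: 'a assume "norm z \<le> e / 2"
      then have "\<bar>W (x + z) - W x\<bar> \<le> e / 2" using W1[of "x + z" x] by simp
      moreover have "\<bar>W x - ?D x\<bar> \<le> e"
        using infdist_nonneg[of x "- S"] e unfolding W_def by linarith
      ultimately show "\<bar>W (x + z) - ?D x\<bar> \<le> 2 * e" using e by linarith
    qed
    have "integral\<^sup>L ?\<mu> (\<lambda>x. w x * ?D x) \<le> integral\<^sup>L ?\<mu> (\<lambda>x. w x * ?f x + 2 * e * \<bar>w x\<bar>)"
    proof (rule integral_mono)
      show "integrable ?\<mu> (\<lambda>x. w x * ?D x)"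
        by (intro int continuous_on_mult w(1) contD)
      show "integrable ?\<mu> (\<lambda>x. w x * ?f x + 2 * e * \<bar>w x\<bar>)"
        by (intro int continuous_intros w(1) contf)
      fix x
      have "w x * (?D x - ?f x) \<le> \<bar>w x\<bar> * \<bar>?D x - ?f x\<bar>"
        by (metis abs_ge_self abs_mult)
      also have "\<dots> \<le> \<bar>w x\<bar> * (2 * e)"
        using close[of x] by (intro mult_left_mono) (simp_all add: abs_minus_commute)
      finally show "w x * ?D x \<le> w x * ?f x + 2 * e * \<bar>w x\<bar>"
        by (simp add: algebra_simps)
    qed
    also have "\<dots> = integral\<^sup>L ?\<mu> (\<lambda>x. w x * ?f x) + 2 * e * I"
      using int[OF continuous_on_mult[OF w(1) contf]] int[OF contabs] by (simp add: I_def)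
    finally have "l * integral\<^sup>L ?\<mu> (\<lambda>x. w x * ?D x)
        \<le> l * (integral\<^sup>L ?\<mu> (\<lambda>x. w x * ?f x) + 2 * e * I)"
      using \<open>l > 0\<close> by (intro mult_left_mono) simp_all
    then show ?thesis using lf by (simp add: distrib_left)
  qed
  show ?thesis
  proof (rule field_le_epsilon)
    fix e :: real assume "e > 0"
    \<comment> \<open>Chosen so that the error l (2 a I) is at most e; the summand 1 keeps the
      denominator positive when I = 0.\<close>
    define a where "a = e / (2 * l * (I + 1))"
    have "a > 0" using \<open>e > 0\<close> \<open>l > 0\<close> \<open>I \<ge> 0\<close> by (simp add: a_def)
    have "a * (2 * l * (I + 1)) = e"
    proof -
      have "2 * l * (I + 1) \<noteq> 0" using \<open>l > 0\<close> \<open>I \<ge> 0\<close> by simp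
      then show ?thesis using a_def by (rule nonzero_eq_divide_eq[THEN iffD1])
    qed
    then have "l * (2 * a * I) = e - 2 * (l * a)" by (simp add: algebra_simps)
    also have "\<dots> \<le> e" using \<open>l > 0\<close> \<open>a > 0\<close> by simp
    finally show "l * integral\<^sup>L ?\<mu> (\<lambda>x. w x * ?D x) \<le> 1 + e"
      using eps[OF \<open>a > 0\<close>] by linarith
  qed
qed

section \<open>Norms through representatives and the comparison of quotients\<close>

lemma L2_inner_self_representative:
  assumes "continuous_on UNIV w" "AE x in lebesgue_on S. v x = w x"
    "v \<in> borel_measurable (lebesgue_on S)"
  shows "L2_inner S v v = integral\<^sup>L (lebesgue_on S) (\<lambda>x. (w x)\<^sup>2)"
  unfolding L2_inner_def
proof (rule integral_cong_AE)
  show "AE x in lebesgue_on S. v x * v x = (w x)\<^sup>2"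
    using assms(2) by eventually_elim (simp add: power2_eq_square)
  show "(\<lambda>x. (w x)\<^sup>2) \<in> borel_measurable (lebesgue_on S)"
    by (intro measurable_lebesgue_on_continuous continuous_intros assms(1))
qed (rule borel_measurable_times[OF assms(3) assms(3)])

lemma integral_square_pos:
  assumes "open S" "bounded S" "continuous_on UNIV w" "AE x in lebesgue_on S. v x = w x"
    and "\<not> ae_zero_on S v"
  shows "0 < integral\<^sup>L (lebesgue_on S) (\<lambda>x. (w x)\<^sup>2)"
proof -
  have int: "integrable (lebesgue_on S) (\<lambda>x. (w x)\<^sup>2)"
    by (intro integrable_lebesgue_on_continuous assms continuous_intros)
  have "integral\<^sup>L (lebesgue_on S) (\<lambda>x. (w x)\<^sup>2) \<noteq> 0"
  proof
    assume "integral\<^sup>L (lebesgue_on S) (\<lambda>x. (w x)\<^sup>2) = 0"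
    then have "AE x in lebesgue_on S. (w x)\<^sup>2 = 0"
      using int by (subst (asm) integral_nonneg_eq_0_iff_AE) simp_all
    then have "AE x in lebesgue_on S. v x = 0"
      using assms(4) by eventually_elim simp
    then show False using assms(5) by (simp add: ae_zero_on_def)
  qed
  moreover have "0 \<le> integral\<^sup>L (lebesgue_on S) (\<lambda>x. (w x)\<^sup>2)"
    by (rule integral_nonneg_AE) simp
  ultimately show ?thesis by linarith
qed

theorem proposition2p14:
  fixes \<Omega> :: "(real ^ 'n) set" and u :: "real ^ 'n \<Rightarrow> real" and l :: real
  assumes "open \<Omega>" and "bounded \<Omega>" and "connected \<Omega>"
    and "u \<in> W1inf0 \<Omega>"
    and "\<not> ae_zero_on \<Omega> u"
    and "AE x in lebesgue_on \<Omega>. u x \<ge> 0"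
    and "l > 0"
    and "(\<lambda>x. l * u x) \<in> subdiff_J \<Omega> u"
  shows "ground_state \<Omega> u"
proof -
  let ?\<mu> = "lebesgue_on \<Omega>"
  let ?D = "\<lambda>x. infdist x (- \<Omega>)"
  have meas: "v \<in> borel_measurable ?\<mu>" if "v \<in> W1inf0 \<Omega>" for v
    using that unfolding W1inf0_def W1inf_def by blast
  note int = integrable_lebesgue_on_continuous[OF assms(1,2)]
  have contD: "continuous_on UNIV ?D" by (intro continuous_intros)
  obtain w where w: "continuous_on UNIV w" "AE x in ?\<mu>. u x = w x"
    and bound: "\<forall>M\<ge>0. J_fun \<Omega> u \<le> ereal M \<longrightarrow> (\<forall>x\<in>\<Omega>. \<bar>w x\<bar> \<le> M * ?D x)"
    using W1inf0_representative[OF assms(1,2,4)] by (elim exE conjE)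
  define L where "L = l * integral\<^sup>L ?\<mu> (\<lambda>x. (w x)\<^sup>2)"
  have "L > 0"
    using integral_square_pos[OF assms(1,2) w assms(5)] assms(7) by (simp add: L_def)
  have "L2_inner \<Omega> (\<lambda>x. l * u x) u = l * L2_inner \<Omega> u u"
    by (simp add: L2_inner_def mult.assoc)
  also have "\<dots> = L"
    unfolding L_def L2_inner_self_representative[OF w meas[OF assms(4)]] ..
  finally have JL: "J_fun \<Omega> u = ereal L"
    using assms(8) by (simp add: subdiff_J_def)
  have wle: "w x \<le> L * ?D x" if "x \<in> \<Omega>" for x
  proof -
    have "\<bar>w x\<bar> \<le> L * ?D x" using bound \<open>L > 0\<close> that by (simp add: JL)
    then show ?thesis by linarith
  qed
  have w0: "w x \<ge> 0" if "x \<in> \<Omega>" for x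
  proof -
    have "AE x in ?\<mu>. w x \<in> {0..}"
      using w(2) assms(6) by eventually_elim simp
    then have "w x \<in> {0..}"
      by (rule AE_lebesgue_on_open_imp_ball[OF assms(1) continuous_on_subset[OF w(1) subset_UNIV]
            closed_atLeast _ that])
    then show ?thesis by simp
  qed
  have prod0: "w x * (L * ?D x - w x) = 0" if "x \<in> \<Omega>" for x
  proof -
    have le: "ereal (L2_inner \<Omega> (\<lambda>x. l * u x) f) \<le> J_fun \<Omega> f" if "f \<in> L2_space \<Omega>" for f
      using assms(8) that by (simp add: subdiff_J_def)
    have tD: "l * integral\<^sup>L ?\<mu> (\<lambda>x. w x * ?D x) \<le> 1"
      by (rule eigenfunction_test_infdist[OF assms(1,2) w meas[OF assms(4)] le assms(7)])
    have cp: "continuous_on UNIV (\<lambda>x. w x * (L * ?D x - w x))"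
      by (intro continuous_intros w(1))
    have nonneg: "AE x in ?\<mu>. 0 \<le> w x * (L * ?D x - w x)"
      by (rule AE_I2) (use w0 wle in simp)
    have "integral\<^sup>L ?\<mu> (\<lambda>x. w x * (L * ?D x - w x))
        = integral\<^sup>L ?\<mu> (\<lambda>x. L * (w x * ?D x) - (w x)\<^sup>2)"
      by (simp add: algebra_simps power2_eq_square)
    also have "\<dots> = L * integral\<^sup>L ?\<mu> (\<lambda>x. w x * ?D x) - integral\<^sup>L ?\<mu> (\<lambda>x. (w x)\<^sup>2)"
    proof -
      have "integrable ?\<mu> (\<lambda>x. w x * ?D x)" "integrable ?\<mu> (\<lambda>x. (w x)\<^sup>2)"
        by (intro int continuous_intros w(1))+
      then show ?thesis by simp
    qed
    finally have eq: "integral\<^sup>L ?\<mu> (\<lambda>x. w x * (L * ?D x - w x))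
        = L * integral\<^sup>L ?\<mu> (\<lambda>x. w x * ?D x) - integral\<^sup>L ?\<mu> (\<lambda>x. (w x)\<^sup>2)" .
    have "l * integral\<^sup>L ?\<mu> (\<lambda>x. w x * (L * ?D x - w x)) = L * (l * integral\<^sup>L ?\<mu> (\<lambda>x. w x * ?D x)) - L"
      unfolding eq by (simp add: L_def algebra_simps)
    also have "\<dots> \<le> L * 1 - L"
      using tD \<open>L > 0\<close> by (intro diff_right_mono mult_left_mono) simp_all
    finally have "integral\<^sup>L ?\<mu> (\<lambda>x. w x * (L * ?D x - w x)) \<le> 0"
      using assms(7) by (simp add: mult_le_0_iff)
    moreover have "0 \<le> integral\<^sup>L ?\<mu> (\<lambda>x. w x * (L * ?D x - w x))"
      by (rule integral_nonneg_AE[OF nonneg])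
    ultimately have "integral\<^sup>L ?\<mu> (\<lambda>x. w x * (L * ?D x - w x)) = 0" by linarith
    then have "AE x in ?\<mu>. w x * (L * ?D x - w x) = 0"
      using integral_nonneg_eq_0_iff_AE[OF int[OF cp] nonneg] by (rule iffD1[rotated])
    then have "AE x in ?\<mu>. w x * (L * ?D x - w x) \<in> {0}" by (simp only: singleton_iff)
    then have "w x * (L * ?D x - w x) \<in> {0}"
      by (rule AE_lebesgue_on_open_imp_ball[OF assms(1) continuous_on_subset[OF cp subset_UNIV]
            closed_singleton _ that])
    then show ?thesis by simp
  qed
  \<comment> \<open>The product vanishes pointwise, so each point chooses one of two closed
    conditions; connectedness makes the choice uniform.\<close>
  have wD: "w x = L * ?D x" if "x \<in> \<Omega>" for x
  proof -
    let ?A = "{x. w x = 0}" and ?B = "{x. w x = L * ?D x}"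
    have "closed ?A" by (rule closed_Collect_eq[OF w(1) continuous_on_const])
    moreover have "closed ?B"
      by (rule closed_Collect_eq[OF w(1)]) (intro continuous_intros)
    moreover have "\<Omega> \<subseteq> ?A \<union> ?B"
    proof
      fix x assume "x \<in> \<Omega>"
      then have "w x = 0 \<or> L * ?D x - w x = 0" using prod0 by (simp only: mult_eq_0_iff)
      then show "x \<in> ?A \<union> ?B" by auto
    qed
    moreover have "?A \<inter> ?B \<inter> \<Omega> = {}"
    proof -
      \<comment> \<open>Positivity of the distance inside \<Omega> makes the alternatives
        exclusive.\<close>
      have "L * ?D x \<noteq> 0" if "x \<in> \<Omega>" for x
      proof -
        have "closed (- \<Omega>)" using assms(1) by (rule closed_Compl)
        moreover have "\<Omega> \<noteq> UNIV" using assms(2) by auto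
        then have "- \<Omega> \<noteq> {}" by blast
        ultimately have "?D x > 0"
          using that by (intro infdist_pos_not_in_closed) simp_all
        then show ?thesis using \<open>L > 0\<close> by simp
      qed
      then show ?thesis by auto
    qed
    ultimately have "?A \<inter> \<Omega> = {} \<or> ?B \<inter> \<Omega> = {}"
      using assms(3) unfolding connected_closed by blast
    \<comment> \<open>If the second alternative never occurred, u would be zero almost
      everywhere.\<close>
    moreover have "?A \<inter> \<Omega> = {}" if "?B \<inter> \<Omega> = {}"
    proof -
      have "AE x in ?\<mu>. w x = 0"
        by (rule AE_I2) (use that \<open>\<Omega> \<subseteq> ?A \<union> ?B\<close> in auto)
      with w(2) have "AE x in ?\<mu>. u x = 0" by eventually_elim simp
      then show ?thesis using assms(5) by (simp add: ae_zero_on_def)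
    qed
    ultimately show ?thesis using \<open>\<Omega> \<subseteq> ?A \<union> ?B\<close> that by blast
  qed
  \<comment> \<open>N is the norm of the distance function: u has quotient 1 / N, and the pointwise
    bound gives every competitor at least this.\<close>
  define N where "N = sqrt (integral\<^sup>L ?\<mu> (\<lambda>x. (?D x)\<^sup>2))"
  have norm_u: "L2_norm \<Omega> u = L * N"
  proof -
    have "L2_inner \<Omega> u u = integral\<^sup>L ?\<mu> (\<lambda>x. (w x)\<^sup>2)"
      by (rule L2_inner_self_representative[OF w meas[OF assms(4)]])
    also have "\<dots> = integral\<^sup>L ?\<mu> (\<lambda>x. L\<^sup>2 * (?D x)\<^sup>2)"
      by (rule Bochner_Integration.integral_cong) (simp_all add: wD power_mult_distrib)
    finally show ?thesis
      using \<open>L > 0\<close> by (simp add: L2_norm_def N_def real_sqrt_mult)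
  qed
  have "L2_norm \<Omega> u > 0"
    using integral_square_pos[OF assms(1,2) w assms(5)]
    by (simp add: L2_norm_def L2_inner_self_representative[OF w meas[OF assms(4)]])
  then have "N > 0" using norm_u \<open>L > 0\<close> by (simp add: zero_less_mult_iff)
  have quot_u: "J_fun \<Omega> u / ereal (L2_norm \<Omega> u) = ereal (1 / N)"
    using \<open>L > 0\<close> \<open>N > 0\<close> by (simp add: JL norm_u)
  have "ereal (1 / N) \<le> J_fun \<Omega> v / ereal (L2_norm \<Omega> v)"
    if v: "v \<in> W1inf0 \<Omega>" "\<not> ae_zero_on \<Omega> v" for v
  proof -
    obtain y where y: "continuous_on UNIV y" "AE x in ?\<mu>. v x = y x"
      and ybound: "\<forall>M\<ge>0. J_fun \<Omega> v \<le> ereal M \<longrightarrow> (\<forall>x\<in>\<Omega>. \<bar>y x\<bar> \<le> M * ?D x)"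
      using W1inf0_representative[OF assms(1,2) v(1)] by (elim exE conjE)
    note self = L2_inner_self_representative[OF y meas[OF v(1)]]
    have normv: "L2_norm \<Omega> v > 0"
      using integral_square_pos[OF assms(1,2) y v(2)] by (simp add: L2_norm_def self)
    \<comment> \<open>Nonpositive J would force the representative to vanish on \<Omega>. This gives
      M > 0 in the finite case and excludes the value -\<infinity> that \<open>ereal\<close>
      admits.\<close>
    have pos: "\<not> J_fun \<Omega> v \<le> ereal 0"
    proof
      assume "J_fun \<Omega> v \<le> ereal 0"
      then have "\<forall>x\<in>\<Omega>. \<bar>y x\<bar> \<le> 0 * ?D x" using ybound by blast
      then have "AE x in ?\<mu>. y x = 0" by (intro AE_I2) simp
      with y(2) have "AE x in ?\<mu>. v x = 0" by eventually_elim simp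
      then show False using v(2) by (simp add: ae_zero_on_def)
    qed
    show ?thesis
    proof (cases "J_fun \<Omega> v")
      case (real M)
      then have "M > 0" using pos by simp
      have "integral\<^sup>L ?\<mu> (\<lambda>x. (y x)\<^sup>2) \<le> integral\<^sup>L ?\<mu> (\<lambda>x. M\<^sup>2 * (?D x)\<^sup>2)"
      proof (rule integral_mono)
        show "integrable ?\<mu> (\<lambda>x. (y x)\<^sup>2)" "integrable ?\<mu> (\<lambda>x. M\<^sup>2 * (?D x)\<^sup>2)"
          by (intro int continuous_intros y(1))+
        fix x assume "x \<in> space ?\<mu>"
        then have "\<bar>y x\<bar> \<le> M * ?D x" using ybound \<open>M > 0\<close> by (simp add: real)
        then have "\<bar>y x\<bar>\<^sup>2 \<le> (M * ?D x)\<^sup>2" by (intro power_mono) simp_all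
        then show "(y x)\<^sup>2 \<le> M\<^sup>2 * (?D x)\<^sup>2" by (simp add: power_mult_distrib)
      qed
      then have "L2_norm \<Omega> v \<le> sqrt (M\<^sup>2 * integral\<^sup>L ?\<mu> (\<lambda>x. (?D x)\<^sup>2))"
        by (simp add: L2_norm_def self)
      then have "L2_norm \<Omega> v \<le> M * N"
        using \<open>M > 0\<close> by (simp add: N_def real_sqrt_mult)
      then have "1 / N \<le> M / L2_norm \<Omega> v"
        using \<open>N > 0\<close> normv by (simp add: field_simps)
      then show ?thesis using normv by (simp add: real)
    next
      case PInf
      then show ?thesis using normv by simp
    next
      case MInf
      then show ?thesis using pos by simp
    qed
  qed
  then show ?thesis
    using assms(4,5) by (simp add: ground_state_def quot_u)
qed

end
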